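(* Let $F$ be a distribution on $\mathbb{R}$ with zero mean, unit variance and finite fourth moment $q$. Consider a sequence of problems with $n\to\infty$, $p=p_n$, $p/n\to\gamma\in(0,1)$, symmetric positive definite matrices $\Sigma=\Sigma_p\in\mathbb{R}^{p\times p}$ whose smallest eigenvalue is bounded away from zero for all $p$, and vectors $\beta=\beta_p\in\mathbb{R}^p$ with $\beta^T\Sigma\beta\to\tau^2$. Suppose that $x=\Sigma^{1/2}\tilde x$, where $\tilde x\in\mathbb{R}^p$ has i.i.d. components with distribution $F$, that $X\in\mathbb{R}^{n\times p}$ has i.i.d. rows distributed as $x$, and that the true linear model $\mathbb{E}[y|x]=x^T\beta$ holds. Then the squared bias term of the semi-supervised OLS estimator $\tilde\beta=H^{-1}X^TY$ satisfies $$B(\tilde\beta)\to\gamma\tau^2 .$$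
   Context: The pairs $(x_1,y_1),\dots,(x_n,y_n)$ are i.i.d. copies of $(x,y)$ with $\mathbb{E}[y|x]=x^T\beta$ and $\mathrm{Var}(y|x)=\sigma^2$. The matrix $X$ has rows $x_i^T$, $Y=(y_1,\dots,y_n)^T$, and $H=\mathbb{E}[X^TX]$. With $x_0$ an independent copy of $x$, the squared bias term is $$B(\tilde\beta)=\mathbb{E}_{X,x_0}\Big(\mathbb{E}[x_0^T\tilde\beta\mid X,x_0]-x_0^T\beta\Big)^2=\frac1n\mathrm{tr}\big(H^{-1}\mathrm{Var}_X(X^TX\beta)\big),$$ where $\mathrm{Var}_X$ of a random vector denotes its covariance matrix. *)

theory Defs
  imports "HOL-Probability.Probability" "Jordan_Normal_Form.Gauss_Jordan_Elimination"
    "Jordan_Normal_Form.Spectral_Radius"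
begin

unbundle no inner_syntax
unbundle no vec_syntax

definition symmetric_mat :: "real mat \<Rightarrow> bool" where
  "symmetric_mat A \<longleftrightarrow> transpose_mat A = A"

definition pos_def_mat :: "real mat \<Rightarrow> bool" where
  "pos_def_mat A \<longleftrightarrow> square_mat A \<and>
     (\<forall>v \<in> carrier_vec (dim_row A). v \<noteq> 0\<^sub>v (dim_row A) \<longrightarrow> 0 < v \<bullet> (A *\<^sub>v v))"

definition pos_semidef_mat :: "real mat \<Rightarrow> bool" where
  "pos_semidef_mat A \<longleftrightarrow> square_mat A \<and>
     (\<forall>v \<in> carrier_vec (dim_row A). 0 \<le> v \<bullet> (A *\<^sub>v v))"

text \<open>A symmetric positive semidefinite matrix \<open>A\<close> has exactly one \<open>R\<close> with this property;
  it is written $A^{1/2}$.\<close>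

definition is_mat_sqrt :: "real mat \<Rightarrow> real mat \<Rightarrow> bool" where
  "is_mat_sqrt R A \<longleftrightarrow> symmetric_mat R \<and> pos_semidef_mat R \<and> R * R = A"

text \<open>Only meaningful for symmetric matrices of positive dimension: all their eigenvalues are real,
  and there is at least one.\<close>

definition smallest_eigenvalue :: "real mat \<Rightarrow> real" where
  "smallest_eigenvalue A = Min (spectrum A)"

text \<open>Only meaningful for invertible \<open>A\<close>.\<close>

definition inv_mat :: "real mat \<Rightarrow> real mat" where
  "inv_mat A = the (mat_inverse A)"

text \<open>The dimension of a vector or matrix is not part of its type, so the Borel
  \<open>\<sigma>\<close>-algebras on $\mathbb{R}^p$ and $\mathbb{R}^{n\times p}$ are those generated by the entries.\<close>

definition vec_borel :: "nat \<Rightarrow> real vec measure" where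
  "vec_borel p = vimage_algebra (carrier_vec p) (\<lambda>v. \<lambda>j\<in>{..<p}. v $ j) (Pi\<^sub>M {..<p} (\<lambda>_. borel))"

definition mat_borel :: "nat \<Rightarrow> nat \<Rightarrow> real mat measure" where
  "mat_borel n p = vimage_algebra (carrier_mat n p) (\<lambda>A. \<lambda>ij\<in>{..<n} \<times> {..<p}. A $$ ij)
     (Pi\<^sub>M ({..<n} \<times> {..<p}) (\<lambda>_. borel))"

text \<open>\<open>cond_exp_given M N Z f\<close> is $\mathbb{E}[f \mid Z]$ for a random element \<open>Z\<close> of \<open>N\<close>, i.e. conditioning
  is on the \<open>\<sigma>\<close>-algebra generated by \<open>Z\<close>; it is a function on the sample space.\<close>

definition cond_exp_given ::
  "'a measure \<Rightarrow> 'b measure \<Rightarrow> ('a \<Rightarrow> 'b) \<Rightarrow> ('a \<Rightarrow> real) \<Rightarrow> 'a \<Rightarrow> real" where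
  "cond_exp_given M N Z f = real_cond_exp M (vimage_algebra (space M) Z N) f"

definition cond_var_given ::
  "'a measure \<Rightarrow> 'b measure \<Rightarrow> ('a \<Rightarrow> 'b) \<Rightarrow> ('a \<Rightarrow> real) \<Rightarrow> 'a \<Rightarrow> real" where
  "cond_var_given M N Z f = cond_exp_given M N Z (\<lambda>\<omega>. (f \<omega> - cond_exp_given M N Z f \<omega>)\<^sup>2)"

definition expectation_mat :: "'a measure \<Rightarrow> nat \<Rightarrow> nat \<Rightarrow> ('a \<Rightarrow> real mat) \<Rightarrow> real mat" where
  "expectation_mat M n p A = mat n p (\<lambda>ij. \<integral>\<omega>. A \<omega> $$ ij \<partial>M)"

text \<open>Square integrability of the response is what makes its conditional mean and (finite)
  conditional variance exist.\<close>

definition linear_model ::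
  "'a measure \<Rightarrow> nat \<Rightarrow> real vec \<Rightarrow> real \<Rightarrow> ('a \<Rightarrow> real vec) \<Rightarrow> ('a \<Rightarrow> real) \<Rightarrow> bool" where
  "linear_model M p \<beta> \<sigma> x y \<longleftrightarrow>
     x \<in> M \<rightarrow>\<^sub>M vec_borel p \<and> y \<in> borel_measurable M \<and> integrable M (\<lambda>\<omega>. (y \<omega>)\<^sup>2) \<and>
     (AE \<omega> in M. cond_exp_given M (vec_borel p) x y \<omega> = x \<omega> \<bullet> \<beta>) \<and>
     (AE \<omega> in M. cond_var_given M (vec_borel p) x y \<omega> = \<sigma>\<^sup>2)"

definition iid_sample ::
  "'a measure \<Rightarrow> nat \<Rightarrow> nat \<Rightarrow> ('a \<Rightarrow> real vec) \<Rightarrow> ('a \<Rightarrow> real) \<Rightarrow>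
   (nat \<Rightarrow> 'a \<Rightarrow> real vec) \<Rightarrow> (nat \<Rightarrow> 'a \<Rightarrow> real) \<Rightarrow> bool" where
  "iid_sample M n p x y xs ys \<longleftrightarrow>
     prob_space.indep_vars M (\<lambda>_. vec_borel p \<Otimes>\<^sub>M borel) (\<lambda>i \<omega>. (xs i \<omega>, ys i \<omega>)) {..<n} \<and>
     (\<forall>i<n. distr M (vec_borel p \<Otimes>\<^sub>M borel) (\<lambda>\<omega>. (xs i \<omega>, ys i \<omega>)) =
            distr M (vec_borel p \<Otimes>\<^sub>M borel) (\<lambda>\<omega>. (x \<omega>, y \<omega>)))"

text \<open>The generated \<open>\<sigma>\<close>-algebras are independent
  (\<open>indep_var\<close> would need both random elements to have the same type).\<close>

definition independent_copy ::
  "'a measure \<Rightarrow> nat \<Rightarrow> nat \<Rightarrow> ('a \<Rightarrow> real vec) \<Rightarrow>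
   (nat \<Rightarrow> 'a \<Rightarrow> real vec) \<Rightarrow> (nat \<Rightarrow> 'a \<Rightarrow> real) \<Rightarrow> ('a \<Rightarrow> real vec) \<Rightarrow> bool" where
  "independent_copy M n p x xs ys x0 \<longleftrightarrow>
     x0 \<in> M \<rightarrow>\<^sub>M vec_borel p \<and>
     prob_space.indep_set M
       (sets (vimage_algebra (space M) x0 (vec_borel p)))
       (sets (vimage_algebra (space M) (\<lambda>\<omega>. \<lambda>i\<in>{..<n}. (xs i \<omega>, ys i \<omega>))
               (Pi\<^sub>M {..<n} (\<lambda>_. vec_borel p \<Otimes>\<^sub>M borel)))) \<and>
     distr M (vec_borel p) x0 = distr M (vec_borel p) x"

definition design_mat :: "nat \<Rightarrow> nat \<Rightarrow> (nat \<Rightarrow> 'a \<Rightarrow> real vec) \<Rightarrow> 'a \<Rightarrow> real mat" where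
  "design_mat n p xs \<omega> = mat n p (\<lambda>(i, j). xs i \<omega> $ j)"

definition response_vec :: "nat \<Rightarrow> (nat \<Rightarrow> 'a \<Rightarrow> real) \<Rightarrow> 'a \<Rightarrow> real vec" where
  "response_vec n ys \<omega> = vec n (\<lambda>i. ys i \<omega>)"

definition expected_gram :: "'a measure \<Rightarrow> nat \<Rightarrow> ('a \<Rightarrow> real mat) \<Rightarrow> real mat" where
  "expected_gram M p X = expectation_mat M p p (\<lambda>\<omega>. transpose_mat (X \<omega>) * X \<omega>)"

definition semisup_ols ::
  "'a measure \<Rightarrow> nat \<Rightarrow> ('a \<Rightarrow> real mat) \<Rightarrow> ('a \<Rightarrow> real vec) \<Rightarrow> 'a \<Rightarrow> real vec" where
  "semisup_ols M p X Y \<omega> = inv_mat (expected_gram M p X) *\<^sub>v (transpose_mat (X \<omega>) *\<^sub>v Y \<omega>)"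

definition squared_bias ::
  "'a measure \<Rightarrow> nat \<Rightarrow> nat \<Rightarrow> real vec \<Rightarrow> ('a \<Rightarrow> real mat) \<Rightarrow> ('a \<Rightarrow> real vec) \<Rightarrow>
   ('a \<Rightarrow> real vec) \<Rightarrow> real" where
  "squared_bias M n p \<beta> X x0 b =
     (\<integral>\<omega>. (cond_exp_given M (mat_borel n p \<Otimes>\<^sub>M vec_borel p) (\<lambda>\<omega>. (X \<omega>, x0 \<omega>))
             (\<lambda>\<omega>. x0 \<omega> \<bullet> b \<omega>) \<omega> - x0 \<omega> \<bullet> \<beta>)\<^sup>2 \<partial>M)"

end

theory Submission
  imports Defs
begin

text \<open>The limit comes from an exact formula: the squared bias equals
  $\frac{p+q-2}{n}\,\beta^T\Sigma\beta$. Conditionally on \<open>X\<close> and \<open>x\<^sub>0\<close>, each response may be replaced by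
  $x_i^T\beta$, and since $H = n\Sigma$ the prediction error becomes the average over \<open>i\<close> of
  $x_0^T(\Sigma^{-1}x_i x_i^T\beta - \beta)$. These summands are centred and, by independence,
  uncorrelated, so the squared bias is \<open>1/n\<close> times the second moment of one of them. Averaging over
  \<open>x\<^sub>0\<close> and whitening with $R = \Sigma^{1/2}$ turns that moment into
  $E\|\tilde x\tilde x^T v - v\|^2$ with $v = R\beta$, which is $(p+q-2)\,\|v\|^2$.\<close>

subsection \<open>Moments of i.i.d. coordinates\<close>

text \<open>The model specifies the mean of a response given its own covariates, whereas the bias
  conditions on all rows and on \<open>x0\<close> at once. Independence removes the extra
  conditioning: once the other observations are frozen, any event of the large sigma-algebra becomes
  an event about \<open>xs i\<close> alone, where the residual integrates to zero. For this and for
  the vanishing cross terms, \<open>x0\<close> and the n data points are treated as one independent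
  family of n + 1 observations, so that expectations of products split by index. The constant comes
  from fourth moments: E[xt_a^2 xt_k^2] is 1 for k distinct from a and \<open>q\<close> for k = a,
  so coordinate a of the whitened error has second moment |v|^2 + (q - 2) v_a^2, and p such terms
  are added. Whitening exposes these independent coordinates: averaging over \<open>x0\<close>
  weights the error by Sigma, the covariance of \<open>x0\<close>, and Sigma = R R turns the
  weighted norm into a plain one. In the limit the term p supplies gamma, while q - 2 is of lower
  order.\<close>

definition square_integrable :: "'a measure \<Rightarrow> ('a \<Rightarrow> real) \<Rightarrow> bool" where
  "square_integrable M f \<longleftrightarrow> f \<in> borel_measurable M \<and> integrable M (\<lambda>\<omega>. (f \<omega>)\<^sup>2)"

lemma square_integrable_measurable [measurable_dest]:
  "square_integrable M f \<Longrightarrow> f \<in> borel_measurable M"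
  by (simp add: square_integrable_def)

lemma square_integrable_cong:
  assumes "\<And>\<omega>. \<omega> \<in> space M \<Longrightarrow> f \<omega> = g \<omega>"
  shows "square_integrable M f \<longleftrightarrow> square_integrable M g"
  using assms unfolding square_integrable_def
  by (intro arg_cong2[of _ _ _ _ "(\<and>)"] measurable_cong Bochner_Integration.integrable_cong) auto

lemma square_integrable_mult:
  assumes "square_integrable M f" "square_integrable M g"
  shows "integrable M (\<lambda>\<omega>. f \<omega> * g \<omega>)"
proof (rule Bochner_Integration.integrable_bound)
  show "integrable M (\<lambda>\<omega>. (f \<omega>)\<^sup>2 + (g \<omega>)\<^sup>2)"
    using assms by (simp add: square_integrable_def)
  show "(\<lambda>\<omega>. f \<omega> * g \<omega>) \<in> borel_measurable M"
    using assms by (auto simp: square_integrable_def intro: borel_measurable_times)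
  have "\<bar>a * b\<bar> \<le> a\<^sup>2 + b\<^sup>2" for a b :: real
  proof -
    have "2 * (\<bar>a\<bar> * \<bar>b\<bar>) \<le> a\<^sup>2 + b\<^sup>2"
      using sum_squares_bound[of "\<bar>a\<bar>" "\<bar>b\<bar>"] by simp
    moreover have "0 \<le> \<bar>a\<bar> * \<bar>b\<bar>"
      by simp
    ultimately show ?thesis
      unfolding abs_mult by linarith
  qed
  then show "AE \<omega> in M. norm (f \<omega> * g \<omega>) \<le> norm ((f \<omega>)\<^sup>2 + (g \<omega>)\<^sup>2)"
    by (simp add: abs_mult)
qed

lemma square_integrable_add:
  assumes "square_integrable M f" "square_integrable M g"
  shows "square_integrable M (\<lambda>\<omega>. f \<omega> + g \<omega>)"
  using assms square_integrable_mult[OF assms]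
  by (auto simp: square_integrable_def power2_sum mult.assoc intro: borel_measurable_add)

lemma square_integrable_cmult:
  "square_integrable M f \<Longrightarrow> square_integrable M (\<lambda>\<omega>. c * f \<omega>)"
  by (auto simp: square_integrable_def power_mult_distrib intro: borel_measurable_times)

lemma (in finite_measure) square_integrable_const: "square_integrable M (\<lambda>_. c)"
  by (simp add: square_integrable_def)

lemma (in finite_measure) square_integrable_diff_const:
  "square_integrable M f \<Longrightarrow> square_integrable M (\<lambda>\<omega>. f \<omega> - c)"
  using square_integrable_add[OF _ square_integrable_const, of f "- c"] by simp

lemma (in finite_measure) square_integrable_sum:
  assumes "\<And>i. i \<in> I \<Longrightarrow> square_integrable M (f i)"
  shows "square_integrable M (\<lambda>\<omega>. \<Sum>i\<in>I. f i \<omega>)"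
  using assms
  by (induction I rule: infinite_finite_induct)
    (auto intro: square_integrable_const square_integrable_add)

lemma (in finite_measure) square_integrable_integrable:
  "square_integrable M f \<Longrightarrow> integrable M f"
  using square_integrable_mult[OF _ square_integrable_const, of f 1] by simp

text \<open>The second moment replaces the variance because raw moments are the factors into which
  expectations of monomials split; with mean zero the two agree.\<close>

locale iid_coordinates = prob_space M for M :: "'a measure" +
  fixes F :: "real measure" and q :: real and d :: nat and X :: "nat \<Rightarrow> 'a \<Rightarrow> real"
  assumes coord_indep: "indep_vars (\<lambda>_. borel) X {..<d}"
    and coord_distr: "\<And>j. j < d \<Longrightarrow> distr M borel (X j) = F"
    and F_real_distribution: "real_distribution F"
    and F_mean: "(\<integral>z. z \<partial>F) = 0"
    and F_second_moment: "(\<integral>z. z\<^sup>2 \<partial>F) = 1"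
    and F_integrable: "integrable F (\<lambda>z. z ^ 4)"
    and F_fourth_moment: "(\<integral>z. z ^ 4 \<partial>F) = q"
begin

lemma coord_measurable [measurable]: "j < d \<Longrightarrow> X j \<in> borel_measurable M"
  using coord_indep by (auto simp: indep_vars_def)

text \<open>Domination by 1 + z^4: for |z| <= 1 the power is at most 1, and for larger |z| it grows
  with the exponent. The fourth moment thus controls all lower ones.\<close>

lemma coord_power_integrable:
  assumes "j < d" "e \<le> 4"
  shows "integrable M (\<lambda>\<omega>. X j \<omega> ^ e)"
proof -
  interpret F: real_distribution F by (rule F_real_distribution)
  have "integrable F (\<lambda>z. z ^ e)"
  proof (rule Bochner_Integration.integrable_bound)
    show "integrable F (\<lambda>z. 1 + z ^ 4)"
      using F_integrable by simp
    show "(\<lambda>z. z ^ e) \<in> borel_measurable F"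
      using F.events_eq_borel by (simp add: measurable_cong_sets[of F borel])
    have "\<bar>z\<bar> ^ e \<le> 1 + z ^ 4" for z :: real
    proof (cases "\<bar>z\<bar> \<le> 1")
      case True
      then show ?thesis
        using power_le_one[of "\<bar>z\<bar>" e] by (smt (verit) abs_ge_zero zero_le_even_power even_numeral)
    next
      case False
      then have "\<bar>z\<bar> ^ e \<le> \<bar>z\<bar> ^ 4"
        using assms by (intro power_increasing) auto
      then show ?thesis by simp
    qed
    then show "AE z in F. norm (z ^ e) \<le> norm (1 + z ^ 4)"
      by (auto simp: power_abs)
  qed
  then show ?thesis
    unfolding coord_distr[OF assms(1), symmetric] using assms
    by (subst (asm) integrable_distr_eq) auto
qed

lemma coord_power_expectation:
  assumes "j < d"
  shows "expectation (\<lambda>\<omega>. X j \<omega> ^ e) = (\<integral>z. z ^ e \<partial>F)"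
  unfolding coord_distr[OF assms, symmetric] using assms by (subst integral_distr) auto

text \<open>The exponent function \<open>e\<close> makes every mixed moment an instance of one
  factorisation. By independence the bound 4 is imposed on each exponent separately, not on the
  total degree.\<close>

lemma monomial:
  assumes "\<And>j. j < d \<Longrightarrow> e j \<le> 4"
  shows "expectation (\<lambda>\<omega>. \<Prod>j<d. X j \<omega> ^ e j) = (\<Prod>j<d. \<integral>z. z ^ e j \<partial>F)"
    and "integrable M (\<lambda>\<omega>. \<Prod>j<d. X j \<omega> ^ e j)"
proof -
  have ind: "indep_vars (\<lambda>_. borel) (\<lambda>j \<omega>. X j \<omega> ^ e j) {..<d}"
    by (rule indep_vars_compose2[OF coord_indep]) simp
  have int: "integrable M (\<lambda>\<omega>. X j \<omega> ^ e j)" if "j \<in> {..<d}" for j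
    using that assms by (intro coord_power_integrable) auto
  show "integrable M (\<lambda>\<omega>. \<Prod>j<d. X j \<omega> ^ e j)"
    by (rule indep_vars_integrable[OF _ ind int]) auto
  show "expectation (\<lambda>\<omega>. \<Prod>j<d. X j \<omega> ^ e j) = (\<Prod>j<d. \<integral>z. z ^ e j \<partial>F)"
    by (subst indep_vars_lebesgue_integral[OF _ ind int])
      (auto intro!: prod.cong simp: coord_power_expectation)
qed

text \<open>A single coordinate becomes a monomial with 0/1 exponents. Products of coordinates then
  correspond to sums of exponents, which treats coinciding and distinct indices uniformly.\<close>

lemma prod_power_of_bool:
  fixes f :: "nat \<Rightarrow> real"
  assumes "a < d"
  shows "(\<Prod>j<d. f j ^ of_bool (j = a)) = f a"
proof -
  have "(\<Prod>j<d. f j ^ of_bool (j = a)) = (\<Prod>j<d. if j = a then f j else 1)"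
    by (rule prod.cong) auto
  then show ?thesis
    using assms by simp
qed

lemma expectation_F_one: "(\<integral>z. z ^ 0 \<partial>F) = 1"
proof -
  interpret F: real_distribution F by (rule F_real_distribution)
  show ?thesis using F.prob_space by simp
qed

lemma second_moment:
  assumes "a < d" "b < d"
  shows "expectation (\<lambda>\<omega>. X a \<omega> * X b \<omega>) = of_bool (a = b)"
    and "integrable M (\<lambda>\<omega>. X a \<omega> * X b \<omega>)"
proof -
  let ?e = "\<lambda>j. of_bool (j = a) + of_bool (j = b) :: nat"
  have eq: "(\<Prod>j<d. X j \<omega> ^ ?e j) = X a \<omega> * X b \<omega>" for \<omega>
    by (simp only: power_add prod.distrib prod_power_of_bool[OF assms(1), of "\<lambda>j. X j \<omega>"]
        prod_power_of_bool[OF assms(2), of "\<lambda>j. X j \<omega>"])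
  have bound: "?e j \<le> 4" for j by simp
  show "integrable M (\<lambda>\<omega>. X a \<omega> * X b \<omega>)"
    using monomial(2)[of ?e] bound by (simp only: eq)
  have "expectation (\<lambda>\<omega>. X a \<omega> * X b \<omega>) = (\<Prod>j<d. \<integral>z. z ^ ?e j \<partial>F)"
    using monomial(1)[of ?e] bound by (simp only: eq)
  also have "\<dots> = of_bool (a = b)"
  proof (cases "a = b")
    case True
    have "(\<integral>z. z ^ ?e j \<partial>F) = 1" for j
      using True F_second_moment expectation_F_one by (cases "j = a") (auto simp: numeral_2_eq_2)
    then show ?thesis using True by simp
  next
    case False
    then have "(\<integral>z. z ^ ?e a \<partial>F) = 0"
      using F_mean by simp
    then show ?thesis
      using False assms by (auto intro!: prod_zero)
  qed
  finally show "expectation (\<lambda>\<omega>. X a \<omega> * X b \<omega>) = of_bool (a = b)" .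
qed

text \<open>If k and l differ, some coordinate occurs exactly once and its zero mean kills the
  product. If they agree, the factors are second moments equal to 1, unless all indices coincide and
  the fourth moment \<open>q\<close> appears.\<close>

lemma fourth_moment:
  assumes "a < d" "k < d" "l < d"
  shows "expectation (\<lambda>\<omega>. (X a \<omega>)\<^sup>2 * (X k \<omega> * X l \<omega>))
      = of_bool (k = l) * (1 + (q - 1) * of_bool (k = a))"
    and "integrable M (\<lambda>\<omega>. (X a \<omega>)\<^sup>2 * (X k \<omega> * X l \<omega>))"
proof -
  let ?e = "\<lambda>j. (of_bool (j = a) + of_bool (j = a)) + (of_bool (j = k) + of_bool (j = l)) :: nat"
  have eq: "(\<Prod>j<d. X j \<omega> ^ ?e j) = (X a \<omega>)\<^sup>2 * (X k \<omega> * X l \<omega>)" for \<omega>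
    by (simp only: power_add prod.distrib prod_power_of_bool[OF assms(1), of "\<lambda>j. X j \<omega>"]
        prod_power_of_bool[OF assms(2), of "\<lambda>j. X j \<omega>"]
        prod_power_of_bool[OF assms(3), of "\<lambda>j. X j \<omega>"] power2_eq_square)
  have bound: "?e j \<le> 4" for j by simp
  show "integrable M (\<lambda>\<omega>. (X a \<omega>)\<^sup>2 * (X k \<omega> * X l \<omega>))"
    using monomial(2)[of ?e] bound by (simp only: eq)
  have "expectation (\<lambda>\<omega>. (X a \<omega>)\<^sup>2 * (X k \<omega> * X l \<omega>)) = (\<Prod>j<d. \<integral>z. z ^ ?e j \<partial>F)"
    using monomial(1)[of ?e] bound by (simp only: eq)
  also have "\<dots> = of_bool (k = l) * (1 + (q - 1) * of_bool (k = a))"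
  proof (cases "k = l")
    case True
    have "(\<integral>z. z ^ ?e j \<partial>F) = (if j = a \<and> k = a then q else 1)" for j
      using True F_second_moment F_fourth_moment expectation_F_one
      by (cases "j = a"; cases "j = k") (auto simp: numeral_2_eq_2 eval_nat_numeral)
    then have "(\<Prod>j<d. \<integral>z. z ^ ?e j \<partial>F) = (\<Prod>j<d. if j = a then (if k = a then q else 1) else 1)"
      by (intro prod.cong) auto
    then show ?thesis using True assms by simp
  next
    case False
    \<comment> \<open>At most one of two distinct indices equals a; \<open>j\<close> is one that
      does not, so its exponent is exactly 1.\<close>
    define j where "j = (if k = a then l else k)"
    have "?e j = 1" "j < d"
      using False assms by (auto simp: j_def)
    then have "(\<integral>z. z ^ ?e j \<partial>F) = 0"
      using F_mean by simp
    then have "(\<Prod>j<d. \<integral>z. z ^ ?e j \<partial>F) = 0"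
      by (rule prod_zero[OF finite_lessThan bexI]) (simp add: \<open>j < d\<close>)
    then show ?thesis
      using False by simp
  qed
  finally show "expectation (\<lambda>\<omega>. (X a \<omega>)\<^sup>2 * (X k \<omega> * X l \<omega>))
      = of_bool (k = l) * (1 + (q - 1) * of_bool (k = a))" .
qed

lemma square_integrable_coord: "a < d \<Longrightarrow> square_integrable M (X a)"
  using coord_power_integrable[of a 2] by (simp add: square_integrable_def)

text \<open>The square has total degree four and is the fourth moment with its last two indices
  equal. This is where finiteness of \<open>q\<close> gives the noise a second moment.\<close>

lemma square_integrable_coord_mult:
  assumes "a < d" "b < d"
  shows "square_integrable M (\<lambda>\<omega>. X a \<omega> * X b \<omega>)"
  using fourth_moment(2)[of a b b] assms
  by (simp add: square_integrable_def power_mult_distrib power2_eq_square[of "X b _"])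

text \<open>The centred image of \<open>v\<close> under the rank-one matrix $\tilde x \tilde x^T$.\<close>

definition rank_one_noise :: "(nat \<Rightarrow> real) \<Rightarrow> nat \<Rightarrow> 'a \<Rightarrow> real" where
  "rank_one_noise v a \<omega> = (\<Sum>k<d. v k * (X k \<omega> * X a \<omega>)) - v a"

lemma square_integrable_rank_one_noise:
  "a < d \<Longrightarrow> square_integrable M (rank_one_noise v a)"
  unfolding rank_one_noise_def
  by (intro square_integrable_diff_const square_integrable_sum square_integrable_cmult
      square_integrable_coord_mult) auto

lemma expectation_rank_one_noise:
  assumes "a < d"
  shows "expectation (rank_one_noise v a) = 0"
proof -
  have "expectation (rank_one_noise v a)
      = (\<Sum>k<d. v k * expectation (\<lambda>\<omega>. X k \<omega> * X a \<omega>)) - v a"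
    unfolding rank_one_noise_def using assms second_moment(2)
    by (subst Bochner_Integration.integral_diff) (auto simp: prob_space)
  also have "(\<Sum>k<d. v k * expectation (\<lambda>\<omega>. X k \<omega> * X a \<omega>)) = (\<Sum>k<d. if k = a then v k else 0)"
    using assms second_moment(1) by (intro sum.cong) auto
  finally show ?thesis
    using assms by simp
qed

text \<open>After expanding the squared sum only the terms with k = l survive. They contribute (v
  k)^2 each, with weight \<open>q\<close> instead of 1 at k = a, hence |v|^2 + (q - 1) (v a)^2. The
  sum has mean \<open>v a\<close>, so centring removes one more (v a)^2.\<close>

lemma expectation_rank_one_noise_square:
  assumes a: "a < d"
  shows "expectation (\<lambda>\<omega>. (rank_one_noise v a \<omega>)\<^sup>2) = (\<Sum>k<d. (v k)\<^sup>2) + (q - 2) * (v a)\<^sup>2"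
proof -
  let ?s = "\<lambda>\<omega>. \<Sum>k<d. v k * (X k \<omega> * X a \<omega>)"
  have s: "square_integrable M ?s"
    using a by (intro square_integrable_sum square_integrable_cmult square_integrable_coord_mult) auto
  have Es: "expectation ?s = v a"
    using expectation_rank_one_noise[OF a, of v] square_integrable_integrable[OF s]
    unfolding rank_one_noise_def by (simp add: prob_space)
  have sq: "(?s \<omega>)\<^sup>2 = (\<Sum>k<d. \<Sum>l<d. v k * v l * ((X a \<omega>)\<^sup>2 * (X k \<omega> * X l \<omega>)))" for \<omega>
    unfolding power2_eq_square sum_product by (intro sum.cong refl) (simp add: ac_simps)
  have int4: "integrable M (\<lambda>\<omega>. v k * v l * ((X a \<omega>)\<^sup>2 * (X k \<omega> * X l \<omega>)))"
    if "k \<in> {..<d}" "l \<in> {..<d}" for k l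
    using that a by (intro integrable_mult_right fourth_moment(2)) auto
  have "expectation (\<lambda>\<omega>. (?s \<omega>)\<^sup>2)
      = (\<Sum>k<d. \<Sum>l<d. v k * v l * expectation (\<lambda>\<omega>. (X a \<omega>)\<^sup>2 * (X k \<omega> * X l \<omega>)))"
    unfolding sq
    by (subst Bochner_Integration.integral_sum, intro Bochner_Integration.integrable_sum int4, assumption+,
        rule sum.cong[OF refl], subst Bochner_Integration.integral_sum, rule int4, assumption+, simp)
  also have "\<dots> = (\<Sum>k<d. \<Sum>l<d. if l = k then (v k)\<^sup>2 * (1 + (q - 1) * of_bool (k = a)) else 0)"
    using a fourth_moment(1) by (intro sum.cong refl) (auto simp: power2_eq_square)
  also have "\<dots> = (\<Sum>k<d. (v k)\<^sup>2 + (if k = a then (q - 1) * (v k)\<^sup>2 else 0))"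
    by (intro sum.cong refl) (auto simp: algebra_simps)
  also have "\<dots> = (\<Sum>k<d. (v k)\<^sup>2) + (q - 1) * (v a)\<^sup>2"
    using a by (simp add: sum.distrib)
  finally have E2: "expectation (\<lambda>\<omega>. (?s \<omega>)\<^sup>2) = (\<Sum>k<d. (v k)\<^sup>2) + (q - 1) * (v a)\<^sup>2" .
  have i2: "integrable M (\<lambda>\<omega>. (?s \<omega>)\<^sup>2)"
    using s by (simp add: square_integrable_def)
  have "expectation (\<lambda>\<omega>. (rank_one_noise v a \<omega>)\<^sup>2)
      = expectation (\<lambda>\<omega>. (?s \<omega>)\<^sup>2 + (v a)\<^sup>2 - (2 * v a) * ?s \<omega>)"
    unfolding rank_one_noise_def power2_diff by (simp add: ac_simps)
  also have "\<dots> = expectation (\<lambda>\<omega>. (?s \<omega>)\<^sup>2) + (v a)\<^sup>2 - (2 * v a) * expectation ?s"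
    using i2 square_integrable_integrable[OF s]
    by (subst Bochner_Integration.integral_diff, simp, simp,
        subst Bochner_Integration.integral_add, simp, simp) (simp only: integral_mult_right_zero, simp add: prob_space)
  also have "\<dots> = (\<Sum>k<d. (v k)\<^sup>2) + (q - 2) * (v a)\<^sup>2"
    unfolding E2 Es by (simp add: algebra_simps power2_eq_square)
  finally show ?thesis .
qed

end

subsection \<open>Vector-valued random elements\<close>

lemma measurable_vec_index [measurable (raw)]:
  assumes "f \<in> N \<rightarrow>\<^sub>M vec_borel d" "j < d"
  shows "(\<lambda>\<omega>. f \<omega> $ j) \<in> borel_measurable N"
proof -
  have "(\<lambda>v. \<lambda>j\<in>{..<d}. v $ j) \<in> vec_borel d \<rightarrow>\<^sub>M Pi\<^sub>M {..<d} (\<lambda>_. borel)"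
    unfolding vec_borel_def by (rule measurable_vimage_algebra1) (auto simp: space_PiM)
  from measurable_compose[OF measurable_compose[OF assms(1) this]
      measurable_component_singleton[of j "{..<d}"]] assms(2)
  show ?thesis by simp
qed

lemma measurable_mat_index:
  assumes "f \<in> N \<rightarrow>\<^sub>M mat_borel n d" "i < n" "j < d"
  shows "(\<lambda>\<omega>. f \<omega> $$ (i, j)) \<in> borel_measurable N"
proof -
  have "(\<lambda>A. \<lambda>ij\<in>{..<n} \<times> {..<d}. A $$ ij) \<in> mat_borel n d \<rightarrow>\<^sub>M Pi\<^sub>M ({..<n} \<times> {..<d}) (\<lambda>_. borel)"
    unfolding mat_borel_def by (rule measurable_vimage_algebra1) (auto simp: space_PiM)
  from measurable_compose[OF measurable_compose[OF assms(1) this]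
      measurable_component_singleton[of "(i, j)" "{..<n} \<times> {..<d}"]] assms(2,3)
  show ?thesis by simp
qed

lemma measurable_mat_borelI:
  assumes "\<And>\<omega>. \<omega> \<in> space N \<Longrightarrow> f \<omega> \<in> carrier_mat n d"
    and "\<And>i j. i < n \<Longrightarrow> j < d \<Longrightarrow> (\<lambda>\<omega>. f \<omega> $$ (i, j)) \<in> borel_measurable N"
  shows "f \<in> N \<rightarrow>\<^sub>M mat_borel n d"
  unfolding mat_borel_def
  using assms by (intro measurable_vimage_algebra2 measurable_restrict) auto

text \<open>The scalar product sums over the dimension of its second argument, so only
  \<open>w\<close> needs a carrier condition. Random vectors can stand on the left without their
  dimension being tracked pointwise.\<close>

lemma scalar_prod_lessThan: "w \<in> carrier_vec d \<Longrightarrow> v \<bullet> w = (\<Sum>j<d. v $ j * w $ j)"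
  by (simp add: scalar_prod_def lessThan_atLeast0)

lemma measurable_scalar_prod [measurable (raw)]:
  assumes "f \<in> N \<rightarrow>\<^sub>M vec_borel d" "w \<in> carrier_vec d"
  shows "(\<lambda>\<omega>. f \<omega> \<bullet> w) \<in> borel_measurable N"
  unfolding scalar_prod_lessThan[OF assms(2)]
  by (intro borel_measurable_sum borel_measurable_times measurable_vec_index[OF assms(1)]) auto

text \<open>An intersection of events from the old family lies in the sigma-algebra generated
  jointly by that family. The event of the new index can therefore be split off first, and the old
  independence handles the rest. This brings the independent copy into the sample.\<close>

lemma (in prob_space) indep_vars_insert:
  assumes I: "finite I" "indep_vars N X I"
    and i: "random_variable (N i) (X i)"
    and indep: "indep_set {X i -` A \<inter> space M | A. A \<in> sets (N i)}
      (sets (vimage_algebra (space M) (\<lambda>\<omega>. \<lambda>j\<in>I. X j \<omega>) (Pi\<^sub>M I N)))"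
  shows "indep_vars N X (insert i I)"
proof -
  let ?F = "\<lambda>j. {X j -` A \<inter> space M | A. A \<in> sets (N j)}"
  let ?V = "vimage_algebra (space M) (\<lambda>\<omega>. \<lambda>j\<in>I. X j \<omega>) (Pi\<^sub>M I N)"
  have rv: "random_variable (N j) (X j)" if "j \<in> insert i I" for j
    using that I(2) i by (auto simp: indep_vars_def)
  have indep_I: "indep_sets ?F I"
    using I(2) by (simp add: indep_vars_def2)
  have V: "?F j \<subseteq> sets ?V" if "j \<in> I" for j
  proof safe
    fix A assume "A \<in> sets (N j)"
    have "(\<lambda>\<omega>. \<lambda>j\<in>I. X j \<omega>) \<in> ?V \<rightarrow>\<^sub>M Pi\<^sub>M I N"
      using measurable_space[OF rv] by (intro measurable_vimage_algebra1) (auto simp: space_PiM)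
    from measurable_compose[OF this measurable_component_singleton[OF that]]
    have "X j \<in> ?V \<rightarrow>\<^sub>M N j"
      using that by simp
    from measurable_sets[OF this \<open>A \<in> sets (N j)\<close>] show "X j -` A \<inter> space M \<in> sets ?V"
      by simp
  qed
  have "indep_sets ?F (insert i I)"
  proof (rule indep_setsI)
    show "?F j \<subseteq> events" if "j \<in> insert i I" for j
      using rv[OF that] by auto
  next
    fix A J assume J: "J \<noteq> {}" "J \<subseteq> insert i I" "finite J" and A: "\<forall>j\<in>J. A j \<in> ?F j"
    show "prob (\<Inter>j\<in>J. A j) = (\<Prod>j\<in>J. prob (A j))"
    \<comment> \<open>Only a set \<open>J\<close> containing both i and older indices needs the new
      hypothesis; otherwise \<open>J\<close> is {i} or lies within \<open>I\<close>.\<close>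
    proof (cases "i \<in> J \<and> J - {i} \<noteq> {}")
      case True
      define K where "K = J - {i}"
      have K: "K \<noteq> {}" "K \<subseteq> I" "finite K" "J = insert i K" "i \<notin> K"
        using True J by (auto simp: K_def)
      have "(\<Inter>j\<in>K. A j) \<in> sets ?V"
        using K A V by (intro sets.finite_INT) blast+
      then have "prob (A i \<inter> (\<Inter>j\<in>K. A j)) = prob (A i) * prob (\<Inter>j\<in>K. A j)"
        using A True by (intro indep_setD[OF indep]) auto
      also have "prob (\<Inter>j\<in>K. A j) = (\<Prod>j\<in>K. prob (A j))"
        using K A by (intro indep_setsD[OF indep_I]) auto
      finally show ?thesis
        using K by simp
    next
      case False
      then consider "J = {i}" | "J \<subseteq> I"
        using J by blast
      then show ?thesis
      proof cases
        case 2
        then show ?thesis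
          using J A by (intro indep_setsD[OF indep_I]) auto
      qed simp
    qed
  qed
  with rv show ?thesis
    by (simp add: indep_vars_def2)
qed

text \<open>Fubini on the product law: with w fixed, the section of \<open>C\<close> is a set of
  \<open>S'\<close>, so the inner integral is zero by hypothesis. Sections treat every set of the
  product sigma-algebra at once, with no argument over generating rectangles.\<close>

lemma (in prob_space) indep_var_integral_eq_zero:
  fixes h :: "'b \<Rightarrow> real"
  assumes indep: "indep_var S U T W"
    and h [measurable]: "h \<in> borel_measurable S" and int: "integrable M (\<lambda>\<omega>. h (U \<omega>))"
    and f [measurable]: "f \<in> S \<rightarrow>\<^sub>M S'"
    and zero: "\<And>A. A \<in> sets S' \<Longrightarrow> expectation (\<lambda>\<omega>. h (U \<omega>) * indicator A (f (U \<omega>))) = 0"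
    and C [measurable]: "C \<in> sets (S' \<Otimes>\<^sub>M T)"
  shows "expectation (\<lambda>\<omega>. h (U \<omega>) * indicator C (f (U \<omega>), W \<omega>)) = 0"
proof -
  have U [measurable]: "U \<in> M \<rightarrow>\<^sub>M S" and W [measurable]: "W \<in> M \<rightarrow>\<^sub>M T"
    and joint: "distr M S U \<Otimes>\<^sub>M distr M T W = distr M (S \<Otimes>\<^sub>M T) (\<lambda>\<omega>. (U \<omega>, W \<omega>))"
    using indep by (auto simp: indep_var_distribution_eq)
  interpret PU: prob_space "distr M S U" by (rule prob_space_distr) (rule U)
  interpret PW: prob_space "distr M T W" by (rule prob_space_distr) (rule W)
  interpret P: pair_prob_space "distr M S U" "distr M T W" ..
  let ?g = "\<lambda>u w. h u * indicator C (f u, w) :: real"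
  have g [measurable]: "case_prod ?g \<in> borel_measurable (S \<Otimes>\<^sub>M T)"
    by measurable
  have "integrable M (\<lambda>\<omega>. ?g (U \<omega>) (W \<omega>))"
    by (rule Bochner_Integration.integrable_bound[OF int]) (auto simp: indicator_def)
  then have gi: "integrable (distr M S U \<Otimes>\<^sub>M distr M T W) (case_prod ?g)"
    unfolding joint by (subst integrable_distr_eq) auto
  have "expectation (\<lambda>\<omega>. ?g (U \<omega>) (W \<omega>)) = integral\<^sup>L (distr M S U \<Otimes>\<^sub>M distr M T W) (case_prod ?g)"
    unfolding joint by (subst integral_distr) auto
  also have "\<dots> = (\<integral>w. (\<integral>u. ?g u w \<partial>distr M S U) \<partial>distr M T W)"
    by (rule P.integral_snd[OF gi, symmetric])
  also have "\<dots> = (\<integral>w. 0 \<partial>distr M T W)"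
  proof (rule Bochner_Integration.integral_cong[OF refl])
    fix w assume w: "w \<in> space (distr M T W)"
    have A: "(\<lambda>s. (s, w)) -` C \<in> sets S'"
      by (rule sets_Pair2[OF C])
    have "(\<integral>u. ?g u w \<partial>distr M S U)
        = (\<integral>u. h u * indicator ((\<lambda>s. (s, w)) -` C) (f u) \<partial>distr M S U)"
      by (simp add: indicator_def)
    also have "\<dots> = expectation (\<lambda>\<omega>. h (U \<omega>) * indicator ((\<lambda>s. (s, w)) -` C) (f (U \<omega>)))"
      using A by (subst integral_distr) auto
    also have "\<dots> = 0"
      by (rule zero[OF A])
    finally show "(\<integral>u. ?g u w \<partial>distr M S U) = 0" .
  qed
  finally show ?thesis by simp
qed

subsection \<open>Conditioning on the design\<close>

locale linear_model_sample = prob_space M for M :: "'a measure" +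
  fixes n d :: nat and \<beta> :: "real vec" and \<sigma> :: real
    and x x0 :: "'a \<Rightarrow> real vec" and y :: "'a \<Rightarrow> real"
    and xs :: "nat \<Rightarrow> 'a \<Rightarrow> real vec" and ys :: "nat \<Rightarrow> 'a \<Rightarrow> real"
  assumes beta_carrier: "\<beta> \<in> carrier_vec d"
    and model: "linear_model M d \<beta> \<sigma> x y"
    and sample: "iid_sample M n d x y xs ys"
    and copy: "independent_copy M n d x xs ys x0"
begin

lemma x_measurable [measurable]: "x \<in> M \<rightarrow>\<^sub>M vec_borel d"
  and y_measurable [measurable]: "y \<in> borel_measurable M"
  using model by (auto simp: linear_model_def)

lemma y_square_integrable: "square_integrable M y"
  using model by (simp add: linear_model_def square_integrable_def)

lemma x0_measurable [measurable]: "x0 \<in> M \<rightarrow>\<^sub>M vec_borel d"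
  using copy by (simp add: independent_copy_def)

lemma pair_measurable:
  "i < n \<Longrightarrow> (\<lambda>\<omega>. (xs i \<omega>, ys i \<omega>)) \<in> M \<rightarrow>\<^sub>M vec_borel d \<Otimes>\<^sub>M borel"
  using sample by (auto simp: iid_sample_def indep_vars_def)

lemma xs_measurable [measurable]: "i < n \<Longrightarrow> xs i \<in> M \<rightarrow>\<^sub>M vec_borel d"
  and ys_measurable [measurable]: "i < n \<Longrightarrow> ys i \<in> borel_measurable M"
  using measurable_compose[OF pair_measurable measurable_fst]
    measurable_compose[OF pair_measurable measurable_snd] by simp_all

lemma pair_distr:
  assumes "i < n"
  shows "distr M (vec_borel d \<Otimes>\<^sub>M borel) (\<lambda>\<omega>. (xs i \<omega>, ys i \<omega>))
    = distr M (vec_borel d \<Otimes>\<^sub>M borel) (\<lambda>\<omega>. (x \<omega>, y \<omega>))"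
  using sample assms by (simp add: iid_sample_def)

lemma pair_integrable:
  assumes "i < n" "f \<in> borel_measurable (vec_borel d \<Otimes>\<^sub>M borel)"
  shows "integrable M (\<lambda>\<omega>. f (xs i \<omega>, ys i \<omega>) :: real) \<longleftrightarrow> integrable M (\<lambda>\<omega>. f (x \<omega>, y \<omega>))"
  using pair_distr[OF assms(1)] assms
  by (simp flip: integrable_distr_eq[OF pair_measurable[OF assms(1)] assms(2)]
      integrable_distr_eq[of "\<lambda>\<omega>. (x \<omega>, y \<omega>)" M "vec_borel d \<Otimes>\<^sub>M borel" f])

lemma pair_expectation:
  assumes "i < n" "f \<in> borel_measurable (vec_borel d \<Otimes>\<^sub>M borel)"
  shows "expectation (\<lambda>\<omega>. f (xs i \<omega>, ys i \<omega>) :: real) = expectation (\<lambda>\<omega>. f (x \<omega>, y \<omega>))"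
  using pair_distr[OF assms(1)] assms
  by (simp flip: integral_distr[OF pair_measurable[OF assms(1)] assms(2)]
      integral_distr[of "\<lambda>\<omega>. (x \<omega>, y \<omega>)" M "vec_borel d \<Otimes>\<^sub>M borel" f])

text \<open>The independent copy is appended to the sample as observation \<open>n\<close>, with the dummy
  response \<open>0\<close>.\<close>

definition obs :: "nat \<Rightarrow> 'a \<Rightarrow> real vec \<times> real" where
  "obs i \<omega> = (if i < n then (xs i \<omega>, ys i \<omega>) else (x0 \<omega>, 0))"

lemma obs_indep: "indep_vars (\<lambda>_. vec_borel d \<Otimes>\<^sub>M borel) obs {..n}"
proof -
  have "indep_vars (\<lambda>_. vec_borel d \<Otimes>\<^sub>M borel) obs (insert n {..<n})"
  proof (rule indep_vars_insert)
    show "indep_vars (\<lambda>_. vec_borel d \<Otimes>\<^sub>M borel) obs {..<n}"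
      using sample unfolding iid_sample_def
      by (subst indep_vars_cong[of "{..<n}" "{..<n}" obs "\<lambda>i \<omega>. (xs i \<omega>, ys i \<omega>)"])
        (auto simp: obs_def)
    have obs_n: "obs n = (\<lambda>\<omega>. (x0 \<omega>, 0))"
      by (auto simp: obs_def)
    show "random_variable (vec_borel d \<Otimes>\<^sub>M borel) (obs n)"
      unfolding obs_n by measurable
    \<comment> \<open>The dummy response is constant, so an event of observation n is an event of
      \<open>x0\<close>, obtained from the section of \<open>A\<close> at 0.\<close>
    have subset: "{obs n -` A \<inter> space M | A. A \<in> sets (vec_borel d \<Otimes>\<^sub>M borel)}
        \<subseteq> sets (vimage_algebra (space M) x0 (vec_borel d))"
    proof safe
      fix A :: "(real vec \<times> real) set" assume "A \<in> sets (vec_borel d \<Otimes>\<^sub>M borel)"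
      then have "(\<lambda>v. (v, 0)) -` A \<in> sets (vec_borel d)"
        by (rule sets_Pair2)
      from in_vimage_algebra[OF this, of x0 "space M"]
      show "obs n -` A \<inter> space M \<in> sets (vimage_algebra (space M) x0 (vec_borel d))"
        by (simp add: obs_n vimage_def)
    qed
    have restrict: "(\<lambda>\<omega>. \<lambda>i\<in>{..<n}. obs i \<omega>) = (\<lambda>\<omega>. \<lambda>i\<in>{..<n}. (xs i \<omega>, ys i \<omega>))"
      by (auto simp: obs_def fun_eq_iff restrict_def)
    have "indep_set (sets (vimage_algebra (space M) x0 (vec_borel d)))
        (sets (vimage_algebra (space M) (\<lambda>\<omega>. \<lambda>i\<in>{..<n}. obs i \<omega>)
               (Pi\<^sub>M {..<n} (\<lambda>_. vec_borel d \<Otimes>\<^sub>M borel))))"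
      using copy unfolding restrict by (simp add: independent_copy_def)
    then show "indep_set {obs n -` A \<inter> space M | A. A \<in> sets (vec_borel d \<Otimes>\<^sub>M borel)}
        (sets (vimage_algebra (space M) (\<lambda>\<omega>. \<lambda>i\<in>{..<n}. obs i \<omega>)
               (Pi\<^sub>M {..<n} (\<lambda>_. vec_borel d \<Otimes>\<^sub>M borel))))"
      unfolding indep_set_def by (rule indep_sets_mono_sets) (use subset in \<open>auto split: bool.split\<close>)
  qed simp
  then show ?thesis
    by (simp add: lessThan_Suc_atMost[symmetric] lessThan_Suc)
qed

abbreviation design :: "'a \<Rightarrow> real mat" where "design \<equiv> design_mat n d xs"

abbreviation design_space :: "(real mat \<times> real vec) measure" where
  "design_space \<equiv> mat_borel n d \<Otimes>\<^sub>M vec_borel d"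

abbreviation design_algebra :: "'a measure" where
  "design_algebra \<equiv> vimage_algebra (space M) (\<lambda>\<omega>. (design \<omega>, x0 \<omega>)) design_space"

lemma design_measurable [measurable]: "design \<in> M \<rightarrow>\<^sub>M mat_borel n d"
  by (rule measurable_mat_borelI) (auto simp: design_mat_def)

lemma design_pair_measurable: "(\<lambda>\<omega>. (design \<omega>, x0 \<omega>)) \<in> M \<rightarrow>\<^sub>M design_space"
  by measurable

lemma subalgebra_design: "subalgebra M design_algebra"
  unfolding subalgebra_def using design_pair_measurable
  by (simp add: sets_image_in_sets)

sublocale design: finite_measure_subalgebra M design_algebra
  by unfold_locales (rule subalgebra_design)

lemma design_algebra_pair: "(\<lambda>\<omega>. (design \<omega>, x0 \<omega>)) \<in> design_algebra \<rightarrow>\<^sub>M design_space"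
  by (rule measurable_vimage_algebra1) (use measurable_space[OF design_pair_measurable] in auto)

lemma x0_design_measurable: "j < d \<Longrightarrow> (\<lambda>\<omega>. x0 \<omega> $ j) \<in> borel_measurable design_algebra"
  using measurable_compose[OF design_algebra_pair measurable_snd]
  by (intro measurable_vec_index[where d = d]) auto

lemma xs_design_measurable:
  assumes "i < n" "j < d"
  shows "(\<lambda>\<omega>. xs i \<omega> $ j) \<in> borel_measurable design_algebra"
proof -
  have "(\<lambda>\<omega>. design \<omega> $$ (i, j)) \<in> borel_measurable design_algebra"
    using measurable_compose[OF design_algebra_pair measurable_fst] assms
    by (intro measurable_mat_index[where n = n and d = d]) auto
  then show ?thesis
    using assms by (simp add: design_mat_def)
qed

text \<open>The defining property of a conditional expectation given \<open>x\<close>, tested on the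
  event that \<open>x\<close> falls in \<open>A\<close>. In this form it can be transferred to each
  sample point by equality of joint laws.\<close>

lemma residual_orthogonal:
  assumes A: "A \<in> sets (vec_borel d)" and int: "integrable M (\<lambda>\<omega>. x \<omega> \<bullet> \<beta>)"
  shows "expectation (\<lambda>\<omega>. (y \<omega> - x \<omega> \<bullet> \<beta>) * indicator A (x \<omega>)) = 0"
proof -
  let ?G = "vimage_algebra (space M) x (vec_borel d)"
  interpret G: finite_measure_subalgebra M ?G
    by unfold_locales (simp add: subalgebra_def sets_image_in_sets)
  have yi: "integrable M y"
    by (rule square_integrable_integrable[OF y_square_integrable])
  have AE: "AE \<omega> in M. real_cond_exp M ?G y \<omega> = x \<omega> \<bullet> \<beta>"
    using model by (simp add: linear_model_def cond_exp_given_def)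
  let ?A = "x -` A \<inter> space M"
  have A': "?A \<in> sets ?G" "?A \<in> sets M"
    using in_vimage_algebra[OF A, of x "space M"] measurable_sets[OF x_measurable A] by auto
  have "expectation (\<lambda>\<omega>. indicator ?A \<omega> * y \<omega>) = expectation (\<lambda>\<omega>. indicator ?A \<omega> * (x \<omega> \<bullet> \<beta>))"
  proof -
    have "(LINT \<omega>:?A|M. y \<omega>) = (LINT \<omega>:?A|M. real_cond_exp M ?G y \<omega>)"
      by (rule G.real_cond_exp_intA[OF yi A'(1)])
    also have "\<dots> = (LINT \<omega>:?A|M. x \<omega> \<bullet> \<beta>)"
      unfolding set_lebesgue_integral_def
      using AE A'(2) beta_carrier by (intro integral_cong_AE) auto
    finally show ?thesis
      by (simp add: set_lebesgue_integral_def)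
  qed
  moreover have "expectation (\<lambda>\<omega>. (y \<omega> - x \<omega> \<bullet> \<beta>) * indicator A (x \<omega>))
      = expectation (\<lambda>\<omega>. indicator ?A \<omega> * y \<omega> - indicator ?A \<omega> * (x \<omega> \<bullet> \<beta>))"
    by (intro Bochner_Integration.integral_cong) (auto simp: indicator_def)
  moreover have "\<dots> = expectation (\<lambda>\<omega>. indicator ?A \<omega> * y \<omega>)
      - expectation (\<lambda>\<omega>. indicator ?A \<omega> * (x \<omega> \<bullet> \<beta>))"
    using integrable_mult_indicator[OF A'(2) yi] integrable_mult_indicator[OF A'(2) int]
    by (intro Bochner_Integration.integral_diff) auto
  ultimately show ?thesis by simp
qed

text \<open>The other rows and \<open>x0\<close> carry no information about response i beyond
  \<open>xs i\<close>. The candidate is measurable for the large sigma-algebra, so it remains to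
  compare integrals over its events, which \<open>indep_var_integral_eq_zero\<close> does with U the
  observation i and W all the others.\<close>

lemma cond_exp_response:
  assumes i: "i < n" and int: "integrable M (\<lambda>\<omega>. x \<omega> \<bullet> \<beta>)"
  shows "AE \<omega> in M. real_cond_exp M design_algebra (ys i) \<omega> = xs i \<omega> \<bullet> \<beta>"
proof (rule design.real_cond_exp_charact)
  note beta_carrier [measurable]
  have yi: "integrable M y"
    by (rule square_integrable_integrable[OF y_square_integrable])
  show ysi: "integrable M (ys i)"
    using pair_integrable[OF i, of snd] yi by simp
  show xsi: "integrable M (\<lambda>\<omega>. xs i \<omega> \<bullet> \<beta>)"
    using pair_integrable[OF i, of "\<lambda>z. fst z \<bullet> \<beta>"] int by simp
  show "(\<lambda>\<omega>. xs i \<omega> \<bullet> \<beta>) \<in> borel_measurable design_algebra"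
    unfolding scalar_prod_lessThan[OF beta_carrier]
    by (intro borel_measurable_sum borel_measurable_times xs_design_measurable[OF i]) auto
  fix B assume "B \<in> sets design_algebra"
  then obtain C where C [measurable]: "C \<in> sets design_space"
    and B: "B = (\<lambda>\<omega>. (design \<omega>, x0 \<omega>)) -` C \<inter> space M"
    using measurable_space[OF design_pair_measurable]
    by (subst (asm) sets_vimage_algebra2) auto
  have BM: "B \<in> sets M"
    using \<open>B \<in> sets design_algebra\<close> subalgebra_design by (auto simp: subalgebra_def)
  let ?N = "\<lambda>_. vec_borel d \<Otimes>\<^sub>M borel :: (real vec \<times> real) measure"
  \<comment> \<open>Observation i is kept as a family over a singleton because independence of
    disjoint index blocks is stated for restricted families.\<close>
  let ?U = "\<lambda>\<omega>. \<lambda>k\<in>{i}. obs k \<omega>" and ?W = "\<lambda>\<omega>. \<lambda>k\<in>{..n} - {i}. obs k \<omega>"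
  let ?T = "Pi\<^sub>M ({..n} - {i}) ?N"
  \<comment> \<open>\<open>\<Psi>\<close> rebuilds the conditioning variable: row i comes from its
    first argument, the other rows from w, and \<open>x0\<close> from entry n of w. Response i does
    not enter.\<close>
  define \<Psi> where "\<Psi> = (\<lambda>(v, w :: nat \<Rightarrow> real vec \<times> real).
      (mat n d (\<lambda>(k, j). if k = i then v $ j else fst (w k) $ j), fst (w n)))"
  have comp: "(\<lambda>z. fst (snd z k)) \<in> vec_borel d \<Otimes>\<^sub>M ?T \<rightarrow>\<^sub>M vec_borel d" if "k \<le> n" "k \<noteq> i" for k
  proof -
    from that have [measurable]: "k \<in> {..n} - {i}" by simp
    show ?thesis by measurable
  qed
  have \<Psi> [measurable]: "\<Psi> \<in> vec_borel d \<Otimes>\<^sub>M ?T \<rightarrow>\<^sub>M design_space"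
    unfolding \<Psi>_def case_prod_beta
  proof (intro measurable_Pair measurable_mat_borelI)
    show "(\<lambda>z. fst (snd z n)) \<in> vec_borel d \<Otimes>\<^sub>M ?T \<rightarrow>\<^sub>M vec_borel d"
      using i by (intro comp) auto
    fix k j assume "k < n" "j < d"
    then show "(\<lambda>z. mat n d (\<lambda>a. if fst a = i then fst z $ snd a else fst (snd z (fst a)) $ snd a) $$ (k, j))
        \<in> borel_measurable (vec_borel d \<Otimes>\<^sub>M ?T)"
      by (cases "k = i") (auto intro!: measurable_vec_index[where d = d] comp)
  qed auto
  have indep: "indep_var (Pi\<^sub>M {i} ?N) ?U ?T ?W"
    using i by (intro indep_var_restrict[OF obs_indep]) auto
  \<comment> \<open>The event is pulled back along \<open>\<Psi>\<close> to covariates i and the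
    other observations; the intersection with the space makes it measurable.\<close>
  have "expectation (\<lambda>\<omega>. (\<lambda>u. snd (u i) - fst (u i) \<bullet> \<beta>) (?U \<omega>)
      * indicator (\<Psi> -` C \<inter> space (vec_borel d \<Otimes>\<^sub>M ?T)) ((\<lambda>u. fst (u i)) (?U \<omega>), ?W \<omega>)) = 0"
  proof (rule indep_var_integral_eq_zero[OF indep])
    show "(\<lambda>u. snd (u i) - fst (u i) \<bullet> \<beta>) \<in> borel_measurable (Pi\<^sub>M {i} ?N)"
      by measurable
    show "(\<lambda>u. fst (u i)) \<in> Pi\<^sub>M {i} ?N \<rightarrow>\<^sub>M vec_borel d"
      by measurable
    show "integrable M (\<lambda>\<omega>. snd (?U \<omega> i) - fst (?U \<omega> i) \<bullet> \<beta>)"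
      using i ysi xsi by (simp add: obs_def)
    show "\<Psi> -` C \<inter> space (vec_borel d \<Otimes>\<^sub>M ?T) \<in> sets (vec_borel d \<Otimes>\<^sub>M ?T)"
      by measurable
  next
    fix A assume A [measurable]: "A \<in> sets (vec_borel d)"
    have "expectation (\<lambda>\<omega>. (ys i \<omega> - xs i \<omega> \<bullet> \<beta>) * indicator A (xs i \<omega>))
        = expectation (\<lambda>\<omega>. (y \<omega> - x \<omega> \<bullet> \<beta>) * indicator A (x \<omega>))"
      using pair_expectation[OF i, of "\<lambda>z. (snd z - fst z \<bullet> \<beta>) * indicator A (fst z)"] by simp
    then show "expectation (\<lambda>\<omega>. (snd (?U \<omega> i) - fst (?U \<omega> i) \<bullet> \<beta>) * indicator A (fst (?U \<omega> i))) = 0"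
      using residual_orthogonal[OF A int] i by (simp add: obs_def)
  qed
  moreover have "(\<lambda>u. snd (u i) - fst (u i) \<bullet> \<beta>) (?U \<omega>)
      * indicator (\<Psi> -` C \<inter> space (vec_borel d \<Otimes>\<^sub>M ?T)) ((\<lambda>u. fst (u i)) (?U \<omega>), ?W \<omega>)
      = indicator B \<omega> * ys i \<omega> - indicator B \<omega> * (xs i \<omega> \<bullet> \<beta>)" if \<omega>: "\<omega> \<in> space M" for \<omega>
  proof -
    have "(xs i \<omega>, ?W \<omega>) \<in> space (vec_borel d \<Otimes>\<^sub>M ?T)"
      using measurable_space[OF xs_measurable[OF i] \<omega>] indep \<omega>
      by (auto simp: indep_var_eq space_pair_measure intro: measurable_space)
    moreover have "\<Psi> (xs i \<omega>, ?W \<omega>) = (design \<omega>, x0 \<omega>)"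
      using i by (auto simp: \<Psi>_def design_mat_def obs_def intro!: eq_matI)
    ultimately show ?thesis
      using \<omega> i by (auto simp: B obs_def indicator_def)
  qed
  ultimately have "expectation (\<lambda>\<omega>. indicator B \<omega> * ys i \<omega> - indicator B \<omega> * (xs i \<omega> \<bullet> \<beta>)) = 0"
    by (simp cong: Bochner_Integration.integral_cong)
  then show "(LINT \<omega>:B|M. ys i \<omega>) = (LINT \<omega>:B|M. xs i \<omega> \<bullet> \<beta>)"
    using integrable_mult_indicator[OF BM ysi] integrable_mult_indicator[OF BM xsi]
    by (simp add: set_lebesgue_integral_def)
qed

end

subsection \<open>The squared bias\<close>

text \<open>A singular matrix would have a nonzero kernel vector, at which the quadratic form
  vanishes. Invertibility is also what gives \<open>inv_mat\<close> its meaning.\<close>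

lemma pos_def_mat_inverse:
  assumes A: "A \<in> carrier_mat d d" and pd: "pos_def_mat A"
  shows "inv_mat A \<in> carrier_mat d d" "inv_mat A * A = 1\<^sub>m d"
proof -
  have "Determinant.det A \<noteq> 0"
  proof
    assume "Determinant.det A = 0"
    then obtain v where v: "v \<in> carrier_vec d" "v \<noteq> 0\<^sub>v d" "A *\<^sub>v v = 0\<^sub>v d"
      using det_0_iff_vec_prod_zero[OF A] by auto
    then have "0 < v \<bullet> (A *\<^sub>v v)"
      using pd A by (auto simp: pos_def_mat_def)
    then show False
      using v by simp
  qed
  then have "A \<in> Units (ring_mat TYPE(real) d ())"
    by (rule det_non_zero_imp_unit[OF A])
  then obtain B where B: "mat_inverse A = Some B"
    using mat_inverse(1)[OF A, where b = "()"] by (cases "mat_inverse A") auto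
  show "inv_mat A \<in> carrier_mat d d" "inv_mat A * A = 1\<^sub>m d"
    using mat_inverse(2)[OF A B] B by (auto simp: inv_mat_def)
qed

lemma index_mult_mat_vec_lessThan:
  "A \<in> carrier_mat n d \<Longrightarrow> v \<in> carrier_vec d \<Longrightarrow> i < n \<Longrightarrow> (A *\<^sub>v v) $ i = (\<Sum>j<d. A $$ (i, j) * v $ j)"
  by (simp add: scalar_prod_lessThan)

lemma index_mult_mat_lessThan:
  "A \<in> carrier_mat n m \<Longrightarrow> B \<in> carrier_mat m d \<Longrightarrow> i < n \<Longrightarrow> j < d \<Longrightarrow>
    (A * B) $$ (i, j) = (\<Sum>k<m. A $$ (i, k) * B $$ (k, j))"
  by (simp add: scalar_prod_lessThan[of _ m])

context linear_model_sample
begin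

lemma obs_measurable: "l \<le> n \<Longrightarrow> obs l \<in> M \<rightarrow>\<^sub>M vec_borel d \<Otimes>\<^sub>M borel"
  using obs_indep by (auto simp: indep_vars_def)

lemma obs_distr:
  assumes "l \<le> n"
  shows "distr M (vec_borel d) (\<lambda>\<omega>. fst (obs l \<omega>)) = distr M (vec_borel d) x"
proof (cases "l < n")
  case True
  have "distr (distr M (vec_borel d \<Otimes>\<^sub>M borel) (\<lambda>\<omega>. (xs l \<omega>, ys l \<omega>))) (vec_borel d) fst
      = distr (distr M (vec_borel d \<Otimes>\<^sub>M borel) (\<lambda>\<omega>. (x \<omega>, y \<omega>))) (vec_borel d) fst"
    using pair_distr[OF True] by simp
  then show ?thesis
    using True by (simp add: distr_distr comp_def obs_def)
next
  case False
  then show ?thesis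
    using copy by (simp add: obs_def independent_copy_def)
qed

text \<open>Confined to functions of the covariates: observation n carries a dummy response, so only
  the first components are known to share a law.\<close>

lemma obs_expectation:
  assumes "l \<le> n" and f: "f \<in> borel_measurable (vec_borel d)"
  shows "expectation (\<lambda>\<omega>. f (fst (obs l \<omega>)) :: real) = expectation (\<lambda>\<omega>. f (x \<omega>))"
    and "integrable M (\<lambda>\<omega>. f (fst (obs l \<omega>))) \<longleftrightarrow> integrable M (\<lambda>\<omega>. f (x \<omega>))"
proof -
  have m: "(\<lambda>\<omega>. fst (obs l \<omega>)) \<in> M \<rightarrow>\<^sub>M vec_borel d"
    using measurable_compose[OF obs_measurable[OF assms(1)] measurable_fst] .
  show "expectation (\<lambda>\<omega>. f (fst (obs l \<omega>))) = expectation (\<lambda>\<omega>. f (x \<omega>))"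
    using integral_distr[OF m f] integral_distr[OF x_measurable f] obs_distr[OF assms(1)] by simp
  show "integrable M (\<lambda>\<omega>. f (fst (obs l \<omega>))) \<longleftrightarrow> integrable M (\<lambda>\<omega>. f (x \<omega>))"
    using integrable_distr_eq[OF m f] integrable_distr_eq[OF x_measurable f] obs_distr[OF assms(1)]
    by simp
qed

lemma obs_prod:
  fixes f :: "nat \<Rightarrow> real vec \<times> real \<Rightarrow> real"
  assumes I: "finite I" "I \<subseteq> {..n}"
    and f: "\<And>l. l \<in> I \<Longrightarrow> f l \<in> borel_measurable (vec_borel d \<Otimes>\<^sub>M borel)"
    and int: "\<And>l. l \<in> I \<Longrightarrow> integrable M (\<lambda>\<omega>. f l (obs l \<omega>))"
  shows "expectation (\<lambda>\<omega>. \<Prod>l\<in>I. f l (obs l \<omega>)) = (\<Prod>l\<in>I. expectation (\<lambda>\<omega>. f l (obs l \<omega>)))"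
    and "integrable M (\<lambda>\<omega>. \<Prod>l\<in>I. f l (obs l \<omega>))"
proof -
  have ind: "indep_vars (\<lambda>_. borel) (\<lambda>l \<omega>. f l (obs l \<omega>)) I"
    using indep_vars_subset[OF obs_indep I(2)] f by (rule indep_vars_compose2)
  show "expectation (\<lambda>\<omega>. \<Prod>l\<in>I. f l (obs l \<omega>)) = (\<Prod>l\<in>I. expectation (\<lambda>\<omega>. f l (obs l \<omega>)))"
    using I(1) ind int by (rule indep_vars_lebesgue_integral)
  show "integrable M (\<lambda>\<omega>. \<Prod>l\<in>I. f l (obs l \<omega>))"
    using I(1) ind int by (rule indep_vars_integrable)
qed

end

section \<open>Whitening by the matrix square root\<close>

locale whitened_linear_model =
  linear_model_sample M n d \<beta> \<sigma> x x0 y xs ys +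
  iid_coordinates M F q d "\<lambda>j \<omega>. xt \<omega> $ j"
  for M :: "'a measure" and n d \<beta> \<sigma> x x0 y xs ys F q and xt :: "'a \<Rightarrow> real vec" +
  fixes S R :: "real mat"
  assumes n_pos: "1 \<le> n"
    and S_carrier: "S \<in> carrier_mat d d" and S_pos_def: "pos_def_mat S"
    and R_carrier: "R \<in> carrier_mat d d" and R_sqrt: "is_mat_sqrt R S"
    and xt_carrier: "\<And>\<omega>. \<omega> \<in> space M \<Longrightarrow> xt \<omega> \<in> carrier_vec d"
    and x_eq: "\<And>\<omega>. \<omega> \<in> space M \<Longrightarrow> x \<omega> = R *\<^sub>v xt \<omega>"
begin

lemma R_square: "R * R = S" and R_symmetric: "transpose_mat R = R"
  using R_sqrt by (auto simp: is_mat_sqrt_def symmetric_mat_def)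

lemma R_entry_commute:
  assumes "i < d" "j < d"
  shows "R $$ (i, j) = R $$ (j, i)"
  using arg_cong[OF R_symmetric, of "\<lambda>A. A $$ (i, j)"] assms R_carrier by simp

text \<open>Symmetry of \<open>R\<close> lets both factors be indexed by their row, the form in
  which a quadratic form in \<open>S\<close> splits into a sum of squares.\<close>

lemma S_entry: "j < d \<Longrightarrow> k < d \<Longrightarrow> S $$ (j, k) = (\<Sum>a<d. R $$ (j, a) * R $$ (k, a))"
  unfolding R_square[symmetric]
  by (subst index_mult_mat_lessThan[OF R_carrier R_carrier])
    (auto intro!: sum.cong simp: R_entry_commute)

lemma x_coord:
  assumes "\<omega> \<in> space M" "j < d"
  shows "x \<omega> $ j = (\<Sum>a<d. R $$ (j, a) * xt \<omega> $ a)"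
  unfolding x_eq[OF assms(1)]
  by (rule index_mult_mat_vec_lessThan[OF R_carrier xt_carrier[OF assms(1)] assms(2)])

lemma x_square_integrable:
  assumes "j < d"
  shows "square_integrable M (\<lambda>\<omega>. x \<omega> $ j)"
proof -
  have "square_integrable M (\<lambda>\<omega>. \<Sum>a<d. R $$ (j, a) * xt \<omega> $ a)"
    by (intro square_integrable_sum square_integrable_cmult square_integrable_coord) auto
  then show ?thesis
    using x_coord assms by (subst square_integrable_cong) auto
qed

lemma x_integrable_mult:
  "j < d \<Longrightarrow> k < d \<Longrightarrow> integrable M (\<lambda>\<omega>. x \<omega> $ j * x \<omega> $ k)"
  by (intro square_integrable_mult x_square_integrable)

lemma x_second_moment:
  assumes "j < d" "k < d"
  shows "expectation (\<lambda>\<omega>. x \<omega> $ j * x \<omega> $ k) = S $$ (j, k)"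
proof -
  have "expectation (\<lambda>\<omega>. x \<omega> $ j * x \<omega> $ k)
      = expectation (\<lambda>\<omega>. \<Sum>a<d. \<Sum>b<d. R $$ (j, a) * R $$ (k, b) * (xt \<omega> $ a * xt \<omega> $ b))"
    using assms
    by (intro Bochner_Integration.integral_cong refl) (simp add: x_coord sum_product ac_simps)
  also have "\<dots> = (\<Sum>a<d. expectation (\<lambda>\<omega>. \<Sum>b<d. R $$ (j, a) * R $$ (k, b) * (xt \<omega> $ a * xt \<omega> $ b)))"
    by (intro Bochner_Integration.integral_sum Bochner_Integration.integrable_sum
        integrable_mult_right second_moment(2)) auto
  also have "\<dots> = (\<Sum>a<d. \<Sum>b<d. R $$ (j, a) * R $$ (k, b) * expectation (\<lambda>\<omega>. xt \<omega> $ a * xt \<omega> $ b))"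
    by (intro sum.cong refl, subst Bochner_Integration.integral_sum)
      (auto intro!: integrable_mult_right second_moment(2))
  also have "\<dots> = (\<Sum>a<d. \<Sum>b<d. if b = a then R $$ (j, a) * R $$ (k, a) else 0)"
    by (intro sum.cong refl) (auto simp: second_moment(1))
  also have "\<dots> = S $$ (j, k)"
    using assms by (simp add: S_entry)
  finally show ?thesis .
qed

lemma x_beta_square_integrable: "square_integrable M (\<lambda>\<omega>. x \<omega> \<bullet> \<beta>)"
proof -
  have "square_integrable M (\<lambda>\<omega>. \<Sum>j<d. \<beta> $ j * x \<omega> $ j)"
    by (intro square_integrable_sum square_integrable_cmult x_square_integrable) auto
  then show ?thesis
    by (simp add: scalar_prod_lessThan[OF beta_carrier] mult.commute)
qed

lemma x_beta_integrable: "integrable M (\<lambda>\<omega>. x \<omega> \<bullet> \<beta>)"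
  by (rule square_integrable_integrable[OF x_beta_square_integrable])

lemma expected_gram_eq: "expected_gram M d design = real n \<cdot>\<^sub>m S"
proof (rule eq_matI)
  fix j k assume "j < dim_row (real n \<cdot>\<^sub>m S)" "k < dim_col (real n \<cdot>\<^sub>m S)"
  then have jk: "j < d" "k < d"
    using S_carrier by auto
  have gram: "(transpose_mat (design \<omega>) * design \<omega>) $$ (j, k) = (\<Sum>i<n. xs i \<omega> $ j * xs i \<omega> $ k)" for \<omega>
    using jk by (subst index_mult_mat_lessThan[of _ d n _ d]) (auto simp: design_mat_def)
  have m: "(\<lambda>v. v $ j * v $ k) \<in> borel_measurable (vec_borel d)"
    using jk by (intro borel_measurable_times measurable_vec_index[where d = d]) auto
  have "expectation (\<lambda>\<omega>. xs i \<omega> $ j * xs i \<omega> $ k) = S $$ (j, k)"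
    "integrable M (\<lambda>\<omega>. xs i \<omega> $ j * xs i \<omega> $ k)" if "i < n" for i
    using obs_expectation[OF _ m, of i] that x_second_moment[OF jk] x_integrable_mult[OF jk]
    by (simp_all add: obs_def)
  then have "expectation (\<lambda>\<omega>. \<Sum>i<n. xs i \<omega> $ j * xs i \<omega> $ k) = real n * S $$ (j, k)"
    by (subst Bochner_Integration.integral_sum) auto
  then show "expected_gram M d design $$ (j, k) = (real n \<cdot>\<^sub>m S) $$ (j, k)"
    using jk S_carrier by (simp add: expected_gram_def expectation_mat_def gram)
qed (use S_carrier in \<open>auto simp: expected_gram_def expectation_mat_def\<close>)

text \<open>This is H^{-1}, that is, Sigma^{-1} / n. It is handled through the identity
  \<open>K_gram\<close> instead of an explicit formula.\<close>

definition K :: "real mat" where "K = inv_mat (expected_gram M d design)"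

lemma K_carrier: "K \<in> carrier_mat d d"
  and K_gram: "K * (real n \<cdot>\<^sub>m S) = 1\<^sub>m d"
proof -
  have c: "real n \<cdot>\<^sub>m S \<in> carrier_mat d d"
    using S_carrier by simp
  have "v \<bullet> (real n \<cdot>\<^sub>m S *\<^sub>v v) = real n * (v \<bullet> (S *\<^sub>v v))" if "v \<in> carrier_vec d" for v
  proof -
    have "real n \<cdot>\<^sub>m S *\<^sub>v v = real n \<cdot>\<^sub>v (S *\<^sub>v v)"
      by (rule eq_vecI) (use that S_carrier in \<open>auto simp: scalar_prod_def sum_distrib_left mult.assoc\<close>)
    then show ?thesis
      using that S_carrier by simp
  qed
  then have "pos_def_mat (real n \<cdot>\<^sub>m S)"
    using S_pos_def S_carrier n_pos by (auto simp: pos_def_mat_def)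
  from pos_def_mat_inverse[OF c this]
  show "K \<in> carrier_mat d d" "K * (real n \<cdot>\<^sub>m S) = 1\<^sub>m d"
    by (auto simp: K_def expected_gram_eq)
qed

text \<open>The inverse of \<open>R\<close>, since n K R = Sigma^{-1} R. Building it from
  \<open>K\<close> derives the invertibility of \<open>R\<close> from that of the Gram
  matrix.\<close>

definition whitener :: "real mat" where "whitener = real n \<cdot>\<^sub>m (K * R)"

lemma whitener_carrier: "whitener \<in> carrier_mat d d"
  using K_carrier R_carrier by (simp add: whitener_def)

lemma whitener_R: "whitener * R = 1\<^sub>m d"
proof -
  have "whitener * R = real n \<cdot>\<^sub>m (K * R * R)"
    using K_carrier R_carrier by (simp add: whitener_def mult_smult_assoc_mat[of _ d d _ d])
  also have "K * R * R = K * S"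
    using K_carrier R_carrier by (simp add: assoc_mult_mat[of _ d d _ d _ d] R_square)
  also have "real n \<cdot>\<^sub>m (K * S) = K * (real n \<cdot>\<^sub>m S)"
    using K_carrier S_carrier by (simp add: mult_smult_distrib[of _ d d _ d])
  finally show ?thesis
    by (simp add: K_gram)
qed

lemma R_whitener: "R * whitener = 1\<^sub>m d"
  by (rule mat_mult_left_right_inverse[OF whitener_carrier R_carrier whitener_R])

lemma whitener_entry:
  assumes "j < d" "a < d"
  shows "whitener $$ (j, a) = real n * (\<Sum>k<d. K $$ (j, k) * R $$ (k, a))"
proof -
  have "whitener $$ (j, a) = real n * (K * R) $$ (j, a)"
    using K_carrier R_carrier assms by (simp add: whitener_def)
  then show ?thesis
    by (simp only: index_mult_mat_lessThan[OF K_carrier R_carrier assms])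
qed

definition signal_coord :: "nat \<Rightarrow> real" where "signal_coord a = (R *\<^sub>v \<beta>) $ a"

lemma whitener_signal:
  assumes "j < d"
  shows "(\<Sum>a<d. whitener $$ (j, a) * signal_coord a) = \<beta> $ j"
proof -
  have c: "R *\<^sub>v \<beta> \<in> carrier_vec d"
    using R_carrier beta_carrier by simp
  have "(\<Sum>a<d. whitener $$ (j, a) * signal_coord a) = (whitener *\<^sub>v (R *\<^sub>v \<beta>)) $ j"
    by (simp only: signal_coord_def index_mult_mat_vec_lessThan[OF whitener_carrier c assms])
  also have "whitener *\<^sub>v (R *\<^sub>v \<beta>) = \<beta>"
    using whitener_R beta_carrier
    by (simp flip: assoc_mult_mat_vec[OF whitener_carrier R_carrier beta_carrier])
  finally show ?thesis .
qed

lemma x_beta_eq: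
  assumes "\<omega> \<in> space M"
  shows "x \<omega> \<bullet> \<beta> = (\<Sum>k<d. signal_coord k * xt \<omega> $ k)"
proof -
  have "x \<omega> \<bullet> \<beta> = (transpose_mat R *\<^sub>v xt \<omega>) \<bullet> \<beta>"
    by (simp add: x_eq assms R_symmetric)
  also have "\<dots> = xt \<omega> \<bullet> (R *\<^sub>v \<beta>)"
    by (rule transpose_vec_mult_scalar[OF R_carrier beta_carrier xt_carrier[OF assms]])
  also have "\<dots> = (\<Sum>k<d. signal_coord k * xt \<omega> $ k)"
    using R_carrier beta_carrier
    by (subst scalar_prod_lessThan[of _ d]) (auto simp: signal_coord_def mult.commute)
  finally show ?thesis .
qed

lemma signal_norm: "(\<Sum>k<d. (signal_coord k)\<^sup>2) = \<beta> \<bullet> (S *\<^sub>v \<beta>)"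
proof -
  have c: "R *\<^sub>v \<beta> \<in> carrier_vec d"
    using R_carrier beta_carrier by simp
  have "(\<Sum>k<d. (signal_coord k)\<^sup>2) = (R *\<^sub>v \<beta>) \<bullet> (R *\<^sub>v \<beta>)"
    by (simp only: scalar_prod_lessThan[OF c] signal_coord_def power2_eq_square)
  also have "\<dots> = (transpose_mat R *\<^sub>v \<beta>) \<bullet> (R *\<^sub>v \<beta>)"
    by (simp add: R_symmetric)
  also have "\<dots> = \<beta> \<bullet> (R *\<^sub>v (R *\<^sub>v \<beta>))"
    by (rule transpose_vec_mult_scalar[OF R_carrier c beta_carrier])
  also have "R *\<^sub>v (R *\<^sub>v \<beta>) = S *\<^sub>v \<beta>"
    by (simp flip: assoc_mult_mat_vec[OF R_carrier R_carrier beta_carrier] add: R_square)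
  finally show ?thesis .
qed

text \<open>The average of \<open>dev\<close> over the rows of \<open>X\<close> is the error $H^{-1}X^TX\beta - \beta$.\<close>

definition dev :: "nat \<Rightarrow> real vec \<Rightarrow> real" where
  "dev j u = real n * (\<Sum>k<d. K $$ (j, k) * u $ k) * (u \<bullet> \<beta>) - \<beta> $ j"

lemma dev_measurable [measurable]: "dev j \<in> borel_measurable (vec_borel d)"
  unfolding dev_def
  by (intro borel_measurable_diff borel_measurable_times borel_measurable_sum borel_measurable_const
      measurable_vec_index[where d = d] measurable_scalar_prod[OF _ beta_carrier]) auto

section \<open>Second moments of the error of a single observation\<close>

abbreviation noise :: "nat \<Rightarrow> 'a \<Rightarrow> real" where
  "noise \<equiv> rank_one_noise signal_coord"

text \<open>With x = R xt, the vector n K x is \<open>whitener\<close> applied to xt, x^T beta is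
  v^T xt, and beta is \<open>whitener\<close> applied to v, where v = R beta. Hence the error vector
  is the whitener applied to xt xt^T v - v.\<close>

lemma dev_x:
  assumes \<omega>: "\<omega> \<in> space M" and j: "j < d"
  shows "dev j (x \<omega>) = (\<Sum>a<d. whitener $$ (j, a) * noise a \<omega>)"
proof -
  let ?s = "\<Sum>k<d. signal_coord k * xt \<omega> $ k"
  have "real n * (\<Sum>k<d. K $$ (j, k) * x \<omega> $ k)
      = real n * (\<Sum>k<d. \<Sum>a<d. K $$ (j, k) * R $$ (k, a) * xt \<omega> $ a)"
    using x_coord[OF \<omega>] by (simp add: sum_distrib_left mult.assoc)
  also have "\<dots> = real n * (\<Sum>a<d. \<Sum>k<d. K $$ (j, k) * R $$ (k, a) * xt \<omega> $ a)"
    by (subst sum.swap) simp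
  also have "\<dots> = (\<Sum>a<d. whitener $$ (j, a) * xt \<omega> $ a)"
    using j by (simp add: whitener_entry sum_distrib_left sum_distrib_right mult.assoc)
  finally have Kx: "real n * (\<Sum>k<d. K $$ (j, k) * x \<omega> $ k) = (\<Sum>a<d. whitener $$ (j, a) * xt \<omega> $ a)" .
  have noise: "noise a \<omega> = ?s * xt \<omega> $ a - signal_coord a" for a
    by (simp add: rank_one_noise_def sum_distrib_right mult.assoc)
  have "(\<Sum>a<d. whitener $$ (j, a) * noise a \<omega>)
      = (\<Sum>a<d. whitener $$ (j, a) * xt \<omega> $ a) * ?s - (\<Sum>a<d. whitener $$ (j, a) * signal_coord a)"
    unfolding noise right_diff_distrib sum_subtractf sum_distrib_right[of _ _ ?s] by (simp add: ac_simps)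
  then show ?thesis
    by (simp only: dev_def Kx x_beta_eq[OF \<omega>] whitener_signal[OF j])
qed

text \<open>Multiplying \<open>dev_x\<close> by \<open>R\<close> cancels the whitener. This needs
  the product in the order \<open>R * whitener\<close>, hence the two-sided inverse.\<close>

lemma R_dev_x:
  assumes \<omega>: "\<omega> \<in> space M" and a: "a < d"
  shows "(\<Sum>j<d. R $$ (j, a) * dev j (x \<omega>)) = noise a \<omega>"
proof -
  have "(\<Sum>j<d. R $$ (j, a) * dev j (x \<omega>))
      = (\<Sum>j<d. \<Sum>b<d. R $$ (j, a) * whitener $$ (j, b) * noise b \<omega>)"
    using \<omega> by (simp add: dev_x sum_distrib_left mult.assoc)
  also have "\<dots> = (\<Sum>b<d. (\<Sum>j<d. R $$ (a, j) * whitener $$ (j, b)) * noise b \<omega>)"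
    using a by (subst sum.swap) (simp add: sum_distrib_right R_entry_commute)
  also have "\<dots> = (\<Sum>b<d. (R * whitener) $$ (a, b) * noise b \<omega>)"
    using index_mult_mat_lessThan[OF R_carrier whitener_carrier a] by simp
  also have "\<dots> = (\<Sum>b<d. if b = a then noise b \<omega> else 0)"
    using a by (intro sum.cong) (auto simp: R_whitener)
  finally show ?thesis
    using a by simp
qed

lemma dev_square_integrable:
  assumes "j < d"
  shows "square_integrable M (\<lambda>\<omega>. dev j (x \<omega>))"
proof -
  have "square_integrable M (\<lambda>\<omega>. \<Sum>a<d. whitener $$ (j, a) * noise a \<omega>)"
    by (intro square_integrable_sum square_integrable_cmult square_integrable_rank_one_noise) auto
  then show ?thesis
    using dev_x assms by (subst square_integrable_cong) auto
qed

lemma dev_expectation: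
  assumes "j < d"
  shows "expectation (\<lambda>\<omega>. dev j (x \<omega>)) = 0"
proof -
  have "expectation (\<lambda>\<omega>. dev j (x \<omega>)) = expectation (\<lambda>\<omega>. \<Sum>a<d. whitener $$ (j, a) * noise a \<omega>)"
    using dev_x assms by (intro Bochner_Integration.integral_cong) auto
  also have "\<dots> = (\<Sum>a<d. whitener $$ (j, a) * expectation (noise a))"
    by (subst Bochner_Integration.integral_sum)
      (auto intro!: integrable_mult_right square_integrable_integrable square_integrable_rank_one_noise)
  also have "\<dots> = 0"
    by (intro sum.neutral) (simp add: expectation_rank_one_noise)
  finally show ?thesis .
qed

text \<open>As \<open>S\<close> is the covariance of \<open>x0\<close>, the left side is the second
  moment of x0^T dev for an independent row. Since S = R R, the form equals |R dev|^2, the squared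
  norm of the noise; its d coordinates each contribute |v|^2, and the corrections (q - 2) (v a)^2
  add up to (q - 2) |v|^2.\<close>

lemma dev_quadratic_form:
  "(\<Sum>j<d. \<Sum>k<d. S $$ (j, k) * expectation (\<lambda>\<omega>. dev j (x \<omega>) * dev k (x \<omega>)))
    = (real d + q - 2) * (\<beta> \<bullet> (S *\<^sub>v \<beta>))"
proof -
  have int: "integrable M (\<lambda>\<omega>. dev j (x \<omega>) * dev k (x \<omega>))" if "j < d" "k < d" for j k
    using that by (intro square_integrable_mult dev_square_integrable)
  have "(\<Sum>j<d. \<Sum>k<d. S $$ (j, k) * expectation (\<lambda>\<omega>. dev j (x \<omega>) * dev k (x \<omega>)))
      = (\<Sum>j<d. expectation (\<lambda>\<omega>. \<Sum>k<d. S $$ (j, k) * (dev j (x \<omega>) * dev k (x \<omega>))))"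
    by (intro sum.cong refl, subst Bochner_Integration.integral_sum) (auto intro!: int integrable_mult_right)
  also have "\<dots> = expectation (\<lambda>\<omega>. \<Sum>j<d. \<Sum>k<d. S $$ (j, k) * (dev j (x \<omega>) * dev k (x \<omega>)))"
    by (intro Bochner_Integration.integral_sum[symmetric] Bochner_Integration.integrable_sum
        integrable_mult_right int) auto
  also have "\<dots> = expectation (\<lambda>\<omega>. \<Sum>a<d. (noise a \<omega>)\<^sup>2)"
  proof (intro Bochner_Integration.integral_cong refl)
    fix \<omega> assume \<omega>: "\<omega> \<in> space M"
    let ?g = "\<lambda>a j. R $$ (j, a) * dev j (x \<omega>)"
    have "(\<Sum>j<d. \<Sum>k<d. S $$ (j, k) * (dev j (x \<omega>) * dev k (x \<omega>)))
        = (\<Sum>j<d. \<Sum>k<d. \<Sum>a<d. ?g a j * ?g a k)"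
      by (intro sum.cong refl) (simp add: S_entry sum_distrib_left sum_distrib_right ac_simps)
    also have "\<dots> = (\<Sum>j<d. \<Sum>a<d. \<Sum>k<d. ?g a j * ?g a k)"
      by (intro sum.cong refl sum.swap)
    also have "\<dots> = (\<Sum>a<d. \<Sum>j<d. \<Sum>k<d. ?g a j * ?g a k)"
      by (rule sum.swap)
    also have "\<dots> = (\<Sum>a<d. (noise a \<omega>)\<^sup>2)"
      using R_dev_x[OF \<omega>] by (intro sum.cong refl) (simp add: power2_eq_square flip: sum_product)
    finally show "(\<Sum>j<d. \<Sum>k<d. S $$ (j, k) * (dev j (x \<omega>) * dev k (x \<omega>))) = (\<Sum>a<d. (noise a \<omega>)\<^sup>2)" .
  qed
  also have "\<dots> = (\<Sum>a<d. expectation (\<lambda>\<omega>. (noise a \<omega>)\<^sup>2))"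
    using square_integrable_rank_one_noise
    by (intro Bochner_Integration.integral_sum) (auto simp: square_integrable_def)
  also have "\<dots> = (\<Sum>a<d. \<beta> \<bullet> (S *\<^sub>v \<beta>) + (q - 2) * (signal_coord a)\<^sup>2)"
    by (intro sum.cong refl) (simp add: expectation_rank_one_noise_square signal_norm)
  also have "\<dots> = real d * (\<beta> \<bullet> (S *\<^sub>v \<beta>)) + (q - 2) * (\<Sum>a<d. (signal_coord a)\<^sup>2)"
    by (simp add: sum.distrib sum_distrib_left)
  also have "\<dots> = (real d + q - 2) * (\<beta> \<bullet> (S *\<^sub>v \<beta>))"
    unfolding signal_norm by (simp add: algebra_simps)
  finally show ?thesis .
qed

section \<open>Conditional mean of the prediction\<close>

abbreviation ols :: "'a \<Rightarrow> real vec" where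
  "ols \<equiv> semisup_ols M d design (response_vec n ys)"

text \<open>The number x0^T H^{-1} x_i, the coefficient of response i in the prediction. Written in
  coordinates, its measurability and integrability reduce to those of entry products.\<close>

definition weight :: "nat \<Rightarrow> 'a \<Rightarrow> real" where
  "weight i \<omega> = (\<Sum>j<d. \<Sum>k<d. K $$ (j, k) * (x0 \<omega> $ j * xs i \<omega> $ k))"

text \<open>The estimator is linear in the responses, with coefficients that depend only on the
  design and \<open>x0\<close>; these can later be pulled out of the conditional
  expectation.\<close>

lemma prediction_eq: "x0 \<omega> \<bullet> ols \<omega> = (\<Sum>i<n. weight i \<omega> * ys i \<omega>)"
proof -
  have Xc: "transpose_mat (design \<omega>) \<in> carrier_mat d n"
    and Yc: "response_vec n ys \<omega> \<in> carrier_vec n"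
    by (auto simp: design_mat_def response_vec_def)
  have XYc: "transpose_mat (design \<omega>) *\<^sub>v response_vec n ys \<omega> \<in> carrier_vec d"
    using Xc Yc by simp
  have ols: "ols \<omega> = K *\<^sub>v (transpose_mat (design \<omega>) *\<^sub>v response_vec n ys \<omega>)"
    by (simp add: semisup_ols_def K_def)
  have c: "ols \<omega> \<in> carrier_vec d"
    unfolding ols using K_carrier XYc by simp
  have XY: "(transpose_mat (design \<omega>) *\<^sub>v response_vec n ys \<omega>) $ k = (\<Sum>i<n. xs i \<omega> $ k * ys i \<omega>)"
    if "k < d" for k
    unfolding index_mult_mat_vec_lessThan[OF Xc Yc that]
    using that by (intro sum.cong) (auto simp: design_mat_def response_vec_def)
  have "x0 \<omega> \<bullet> ols \<omega> = (\<Sum>j<d. x0 \<omega> $ j * (\<Sum>k<d. K $$ (j, k) * (\<Sum>i<n. xs i \<omega> $ k * ys i \<omega>)))"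
    unfolding scalar_prod_lessThan[OF c]
    by (intro sum.cong refl arg_cong2[where f = "(*)"])
      (simp add: ols index_mult_mat_vec_lessThan[OF K_carrier XYc] XY del: index_mult_mat_vec)
  also have "\<dots> = (\<Sum>j<d. \<Sum>k<d. \<Sum>i<n. K $$ (j, k) * (x0 \<omega> $ j * xs i \<omega> $ k) * ys i \<omega>)"
    by (simp add: sum_distrib_left ac_simps)
  also have "\<dots> = (\<Sum>j<d. \<Sum>i<n. \<Sum>k<d. K $$ (j, k) * (x0 \<omega> $ j * xs i \<omega> $ k) * ys i \<omega>)"
    by (intro sum.cong refl sum.swap)
  also have "\<dots> = (\<Sum>i<n. \<Sum>j<d. \<Sum>k<d. K $$ (j, k) * (x0 \<omega> $ j * xs i \<omega> $ k) * ys i \<omega>)"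
    by (rule sum.swap)
  also have "\<dots> = (\<Sum>i<n. weight i \<omega> * ys i \<omega>)"
    by (simp add: weight_def sum_distrib_right)
  finally show ?thesis .
qed

lemma weight_design_measurable:
  "i < n \<Longrightarrow> weight i \<in> borel_measurable design_algebra"
  unfolding weight_def
  by (intro borel_measurable_sum borel_measurable_times borel_measurable_const
      x0_design_measurable xs_design_measurable) auto

lemma x_response_integrable:
  assumes "k < d" "i < n"
  shows "integrable M (\<lambda>\<omega>. xs i \<omega> $ k * ys i \<omega>)"
proof -
  have "(\<lambda>z. fst z $ k * snd z) \<in> borel_measurable (vec_borel d \<Otimes>\<^sub>M borel)"
    using assms by (intro borel_measurable_times measurable_vec_index[where d = d]) auto
  from pair_integrable[OF assms(2) this] show ?thesis
    using square_integrable_mult[OF x_square_integrable[OF assms(1)] y_square_integrable] by simp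
qed

lemma x0_integrable:
  assumes "j < d"
  shows "integrable M (\<lambda>\<omega>. x0 \<omega> $ j)"
proof -
  have "(\<lambda>v. v $ j) \<in> borel_measurable (vec_borel d)"
    using assms by (intro measurable_vec_index[where d = d]) auto
  from obs_expectation(2)[OF order_refl this] show ?thesis
    using square_integrable_integrable[OF x_square_integrable[OF assms]] by (simp add: obs_def)
qed

text \<open>Each term has three random factors, so square integrability of the factors alone does
  not suffice. The product of an entry of \<open>xs i\<close> with \<open>ys i\<close> is integrable
  as a product of two square integrable functions, and the entry of \<open>x0\<close> is integrable
  and independent of it.\<close>

lemma weight_response_integrable:
  assumes i: "i < n"
  shows "integrable M (\<lambda>\<omega>. weight i \<omega> * ys i \<omega>)"
proof -
  have int: "integrable M (\<lambda>\<omega>. x0 \<omega> $ j * (xs i \<omega> $ k * ys i \<omega>))" if jk: "j < d" "k < d" for j k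
  proof -
    let ?f = "\<lambda>l z. if l = n then fst z $ j else fst z $ k * snd z"
    have "integrable M (\<lambda>\<omega>. \<Prod>l\<in>{n, i}. ?f l (obs l \<omega>))"
    proof (rule obs_prod(2))
      fix l assume "l \<in> {n, i}"
      then show "?f l \<in> borel_measurable (vec_borel d \<Otimes>\<^sub>M borel)"
        using jk by (cases "l = n") (auto intro!: borel_measurable_times measurable_vec_index[where d = d])
      show "integrable M (\<lambda>\<omega>. ?f l (obs l \<omega>))"
        using \<open>l \<in> {n, i}\<close> i x0_integrable[OF jk(1)] x_response_integrable[OF jk(2) i]
        by (cases "l = n") (auto simp: obs_def)
    qed (use i in auto)
    then show ?thesis
      using i by (simp add: obs_def)
  qed
  have "integrable M (\<lambda>\<omega>. \<Sum>j<d. \<Sum>k<d. K $$ (j, k) * (x0 \<omega> $ j * (xs i \<omega> $ k * ys i \<omega>)))"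
    by (intro Bochner_Integration.integrable_sum integrable_mult_right int) auto
  then show ?thesis
    by (simp add: weight_def sum_distrib_right mult.assoc)
qed

lemma cond_exp_prediction:
  "AE \<omega> in M. cond_exp_given M design_space (\<lambda>\<omega>. (design \<omega>, x0 \<omega>)) (\<lambda>\<omega>. x0 \<omega> \<bullet> ols \<omega>) \<omega>
    = (\<Sum>i<n. weight i \<omega> * (xs i \<omega> \<bullet> \<beta>))"
proof -
  have "AE \<omega> in M. real_cond_exp M design_algebra (\<lambda>\<omega>. \<Sum>i<n. weight i \<omega> * ys i \<omega>) \<omega>
      = (\<Sum>i<n. real_cond_exp M design_algebra (\<lambda>\<omega>. weight i \<omega> * ys i \<omega>) \<omega>)"
  proof -
    \<comment> \<open>Padding by zero outside i < n: the summation rule for conditional expectations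
      asks for integrability at every index, not only at those summed.\<close>
    let ?f = "\<lambda>i \<omega>. if i < n then weight i \<omega> * ys i \<omega> else 0"
    have "integrable M (?f i)" for i
      using weight_response_integrable by (cases "i < n") auto
    note sum = design.real_cond_exp_sum[of ?f "{..<n}", OF this]
    have "(\<lambda>\<omega>. \<Sum>i<n. ?f i \<omega>) = (\<lambda>\<omega>. \<Sum>i<n. weight i \<omega> * ys i \<omega>)"
      by (intro ext sum.cong) auto
    moreover have "(\<Sum>i<n. real_cond_exp M design_algebra (?f i) \<omega>)
        = (\<Sum>i<n. real_cond_exp M design_algebra (\<lambda>\<omega>. weight i \<omega> * ys i \<omega>) \<omega>)" for \<omega>
      by (intro sum.cong) auto
    ultimately show ?thesis
      using sum by simp
  qed
  moreover have "AE \<omega> in M. \<forall>i\<in>{..<n}. real_cond_exp M design_algebra (\<lambda>\<omega>. weight i \<omega> * ys i \<omega>) \<omega>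
      = weight i \<omega> * (xs i \<omega> \<bullet> \<beta>)"
  proof (rule AE_finite_allI)
    fix i assume "i \<in> {..<n}"
    then have i: "i < n" by simp
    have "AE \<omega> in M. real_cond_exp M design_algebra (\<lambda>\<omega>. weight i \<omega> * ys i \<omega>) \<omega>
        = weight i \<omega> * real_cond_exp M design_algebra (ys i) \<omega>"
      by (rule design.real_cond_exp_mult[OF weight_design_measurable[OF i] ys_measurable[OF i]
            weight_response_integrable[OF i]])
    with cond_exp_response[OF i x_beta_integrable]
    show "AE \<omega> in M. real_cond_exp M design_algebra (\<lambda>\<omega>. weight i \<omega> * ys i \<omega>) \<omega>
        = weight i \<omega> * (xs i \<omega> \<bullet> \<beta>)"
      by eventually_elim simp
  qed simp
  ultimately show ?thesis
    unfolding cond_exp_given_def prediction_eq by eventually_elim simp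
qed

section \<open>Uncorrelated bias terms and the exact formula\<close>

definition bias_term :: "nat \<Rightarrow> 'a \<Rightarrow> real" where
  "bias_term i \<omega> = (\<Sum>j<d. x0 \<omega> $ j * dev j (xs i \<omega>))"

text \<open>The true value x0^T beta is spread evenly over the n rows; this is the subtracted beta
  in \<open>dev\<close> and leaves every summand centred.\<close>

lemma weight_bias:
  "(\<Sum>i<n. weight i \<omega> * (xs i \<omega> \<bullet> \<beta>)) - x0 \<omega> \<bullet> \<beta> = (\<Sum>i<n. bias_term i \<omega>) / real n"
proof -
  have "bias_term i \<omega> = real n * (weight i \<omega> * (xs i \<omega> \<bullet> \<beta>)) - x0 \<omega> \<bullet> \<beta>" for i
    by (simp add: bias_term_def dev_def weight_def scalar_prod_lessThan[OF beta_carrier, of "x0 \<omega>"]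
        right_diff_distrib sum_subtractf sum_distrib_left sum_distrib_right ac_simps)
  then have "(\<Sum>i<n. bias_term i \<omega>) = real n * ((\<Sum>i<n. weight i \<omega> * (xs i \<omega> \<bullet> \<beta>)) - x0 \<omega> \<bullet> \<beta>)"
    by (simp add: sum_subtractf sum_distrib_left right_diff_distrib)
  then show ?thesis
    using n_pos by simp
qed

text \<open>Independence of \<open>x0\<close> from the rows separates the factor E[x0_j x0_k] =
  S_jk. Two distinct rows separate as well, and each of their factors has mean zero.\<close>

lemma x0_dev_dev:
  assumes "i < n" "i' < n" "j < d" "k < d"
  shows "expectation (\<lambda>\<omega>. (x0 \<omega> $ j * x0 \<omega> $ k) * (dev j (xs i \<omega>) * dev k (xs i' \<omega>)))
      = (if i = i' then S $$ (j, k) * expectation (\<lambda>\<omega>. dev j (x \<omega>) * dev k (x \<omega>)) else 0)"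
    and "integrable M (\<lambda>\<omega>. (x0 \<omega> $ j * x0 \<omega> $ k) * (dev j (xs i \<omega>) * dev k (xs i' \<omega>)))"
proof -
  \<comment> \<open>Every index receives the product of the factors that belong to it. For i = i'
    the set {n, i, i'} collapses and both \<open>dev\<close> factors fall on the same observation,
    so one product formula covers both cases.\<close>
  define g where "g = (\<lambda>l u. if l = n then u $ j * u $ k
      else (if l = i then dev j u else 1) * (if l = i' then dev k u else 1))"
  define f where "f = (\<lambda>l (z :: real vec \<times> real). g l (fst z))"
  let ?I = "{n, i, i'}"
  have g: "g l \<in> borel_measurable (vec_borel d)" for l
    using assms unfolding g_def
    by (cases "l = n"; cases "l = i"; cases "l = i'")
      (auto intro!: borel_measurable_times measurable_vec_index[where d = d])
  have gi: "integrable M (\<lambda>\<omega>. g l (x \<omega>))" for l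
    using assms x_integrable_mult square_integrable_mult[OF dev_square_integrable dev_square_integrable]
      square_integrable_integrable[OF dev_square_integrable] unfolding g_def
    by (cases "l = n"; cases "l = i"; cases "l = i'") auto
  have f: "f l \<in> borel_measurable (vec_borel d \<Otimes>\<^sub>M borel)" for l
    unfolding f_def by (rule measurable_compose[OF measurable_fst g])
  have fi: "integrable M (\<lambda>\<omega>. f l (obs l \<omega>))" if "l \<in> ?I" for l
    using obs_expectation(2)[OF _ g, of l] gi that assms by (auto simp: f_def)
  have prod_eq: "(\<Prod>l\<in>?I. f l (obs l \<omega>)) = (x0 \<omega> $ j * x0 \<omega> $ k) * (dev j (xs i \<omega>) * dev k (xs i' \<omega>))" for \<omega>
    using assms by (cases "i = i'") (auto simp: f_def g_def obs_def)
  have I: "finite ?I" "?I \<subseteq> {..n}"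
    using assms by auto
  show "integrable M (\<lambda>\<omega>. (x0 \<omega> $ j * x0 \<omega> $ k) * (dev j (xs i \<omega>) * dev k (xs i' \<omega>)))"
    using obs_prod(2)[OF I f fi] by (simp only: prod_eq)
  have "expectation (\<lambda>\<omega>. (x0 \<omega> $ j * x0 \<omega> $ k) * (dev j (xs i \<omega>) * dev k (xs i' \<omega>)))
      = (\<Prod>l\<in>?I. expectation (\<lambda>\<omega>. f l (obs l \<omega>)))"
    using obs_prod(1)[OF I f fi] by (simp only: prod_eq)
  also have "\<dots> = (\<Prod>l\<in>?I. expectation (\<lambda>\<omega>. g l (x \<omega>)))"
    using assms by (intro prod.cong refl) (auto simp: f_def obs_expectation(1)[OF _ g])
  also have "\<dots> = (if i = i' then S $$ (j, k) * expectation (\<lambda>\<omega>. dev j (x \<omega>) * dev k (x \<omega>)) else 0)"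
    using assms by (auto simp: g_def x_second_moment dev_expectation)
  finally show "expectation (\<lambda>\<omega>. (x0 \<omega> $ j * x0 \<omega> $ k) * (dev j (xs i \<omega>) * dev k (xs i' \<omega>)))
      = (if i = i' then S $$ (j, k) * expectation (\<lambda>\<omega>. dev j (x \<omega>) * dev k (x \<omega>)) else 0)" .
qed

lemma bias_term_product:
  assumes "i < n" "i' < n"
  shows "expectation (\<lambda>\<omega>. bias_term i \<omega> * bias_term i' \<omega>)
      = (if i = i' then (real d + q - 2) * (\<beta> \<bullet> (S *\<^sub>v \<beta>)) else 0)"
    and "integrable M (\<lambda>\<omega>. bias_term i \<omega> * bias_term i' \<omega>)"
proof -
  let ?h = "\<lambda>j k \<omega>. (x0 \<omega> $ j * x0 \<omega> $ k) * (dev j (xs i \<omega>) * dev k (xs i' \<omega>))"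
  have eq: "bias_term i \<omega> * bias_term i' \<omega> = (\<Sum>j<d. \<Sum>k<d. ?h j k \<omega>)" for \<omega>
    by (simp add: bias_term_def sum_product ac_simps)
  show "integrable M (\<lambda>\<omega>. bias_term i \<omega> * bias_term i' \<omega>)"
    unfolding eq using assms by (intro Bochner_Integration.integrable_sum x0_dev_dev(2)) auto
  have "expectation (\<lambda>\<omega>. bias_term i \<omega> * bias_term i' \<omega>) = (\<Sum>j<d. expectation (\<lambda>\<omega>. \<Sum>k<d. ?h j k \<omega>))"
    unfolding eq using assms
    by (intro Bochner_Integration.integral_sum Bochner_Integration.integrable_sum x0_dev_dev(2)) auto
  also have "\<dots> = (\<Sum>j<d. \<Sum>k<d. expectation (?h j k))"
    using assms by (intro sum.cong refl Bochner_Integration.integral_sum x0_dev_dev(2)) auto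
  also have "\<dots> = (\<Sum>j<d. \<Sum>k<d. if i = i' then S $$ (j, k) * expectation (\<lambda>\<omega>. dev j (x \<omega>) * dev k (x \<omega>)) else 0)"
    using assms by (intro sum.cong refl x0_dev_dev(1)) auto
  also have "\<dots> = (if i = i' then (real d + q - 2) * (\<beta> \<bullet> (S *\<^sub>v \<beta>)) else 0)"
    using dev_quadratic_form by simp
  finally show "expectation (\<lambda>\<omega>. bias_term i \<omega> * bias_term i' \<omega>)
      = (if i = i' then (real d + q - 2) * (\<beta> \<bullet> (S *\<^sub>v \<beta>)) else 0)" .
qed

text \<open>Of the n^2 products of bias terms only the n diagonal ones have nonzero mean allowed,
  all with the same value; against the factor 1 / n^2 this leaves 1 / n.\<close>

lemma squared_bias_eq:
  "squared_bias M n d \<beta> design x0 ols = (real d + q - 2) / real n * (\<beta> \<bullet> (S *\<^sub>v \<beta>))"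
proof -
  let ?E = "cond_exp_given M design_space (\<lambda>\<omega>. (design \<omega>, x0 \<omega>)) (\<lambda>\<omega>. x0 \<omega> \<bullet> ols \<omega>)"
  note beta_carrier [measurable]
  have [measurable]: "?E \<in> borel_measurable M"
    unfolding cond_exp_given_def by (rule borel_measurable_cond_exp2)
  have [measurable]: "bias_term i \<in> borel_measurable M" if "i < n" for i
    unfolding bias_term_def using that
    by (intro borel_measurable_sum borel_measurable_times measurable_vec_index[OF x0_measurable]
        measurable_compose[OF xs_measurable dev_measurable]) auto
  have "squared_bias M n d \<beta> design x0 ols = expectation (\<lambda>\<omega>. (?E \<omega> - x0 \<omega> \<bullet> \<beta>)\<^sup>2)"
    by (simp add: squared_bias_def)
  also have "\<dots> = expectation (\<lambda>\<omega>. ((\<Sum>i<n. bias_term i \<omega>) / real n)\<^sup>2)"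
  proof (rule integral_cong_AE)
    show "AE \<omega> in M. (?E \<omega> - x0 \<omega> \<bullet> \<beta>)\<^sup>2 = ((\<Sum>i<n. bias_term i \<omega>) / real n)\<^sup>2"
      using cond_exp_prediction by eventually_elim (simp add: weight_bias)
  qed measurable
  also have "\<dots> = expectation (\<lambda>\<omega>. (\<Sum>i<n. \<Sum>i'<n. bias_term i \<omega> * bias_term i' \<omega>)) / (real n)\<^sup>2"
    by (simp add: power_divide power2_eq_square sum_product)
  also have "expectation (\<lambda>\<omega>. (\<Sum>i<n. \<Sum>i'<n. bias_term i \<omega> * bias_term i' \<omega>))
      = (\<Sum>i<n. expectation (\<lambda>\<omega>. \<Sum>i'<n. bias_term i \<omega> * bias_term i' \<omega>))"
    by (intro Bochner_Integration.integral_sum Bochner_Integration.integrable_sum bias_term_product(2)) auto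
  also have "\<dots> = (\<Sum>i<n. \<Sum>i'<n. expectation (\<lambda>\<omega>. bias_term i \<omega> * bias_term i' \<omega>))"
    by (intro sum.cong refl Bochner_Integration.integral_sum bias_term_product(2)) auto
  also have "\<dots> = (\<Sum>i<n. \<Sum>i'<n. if i = i' then (real d + q - 2) * (\<beta> \<bullet> (S *\<^sub>v \<beta>)) else 0)"
    by (intro sum.cong refl bias_term_product(1)) auto
  also have "\<dots> / (real n)\<^sup>2 = (real d + q - 2) / real n * (\<beta> \<bullet> (S *\<^sub>v \<beta>))"
    using n_pos by (simp add: power2_eq_square)
  finally show ?thesis .
qed

end

section \<open>Passage to the limit\<close>

theorem proposition2:
  fixes F :: "real measure" and q \<gamma> \<tau> :: real
    and p :: "nat \<Rightarrow> nat" and \<Sigma> R :: "nat \<Rightarrow> real mat"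
    and \<beta> :: "nat \<Rightarrow> real vec" and \<sigma> :: "nat \<Rightarrow> real"
    and M :: "nat \<Rightarrow> 'a measure"
    and xt x x0 :: "nat \<Rightarrow> 'a \<Rightarrow> real vec" and y :: "nat \<Rightarrow> 'a \<Rightarrow> real"
    and xs :: "nat \<Rightarrow> nat \<Rightarrow> 'a \<Rightarrow> real vec" and ys :: "nat \<Rightarrow> nat \<Rightarrow> 'a \<Rightarrow> real"
  assumes F_distribution: "real_distribution F"
    and F_mean: "prob_space.expectation F (\<lambda>z. z) = 0"
    and F_variance: "prob_space.variance F (\<lambda>z. z) = 1"
    and F_fourth_moment: "integrable F (\<lambda>z. z ^ 4)"
      "prob_space.expectation F (\<lambda>z. z ^ 4) = q"
    and ratio: "(\<lambda>n. real (p n) / real n) \<longlonglongrightarrow> \<gamma>" "0 < \<gamma>" "\<gamma> < 1"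
    and p_pos: "\<And>n. 1 \<le> n \<Longrightarrow> 1 \<le> p n"
    and Sigma_dim: "\<And>n. 1 \<le> n \<Longrightarrow> \<Sigma> n \<in> carrier_mat (p n) (p n)"
    and Sigma_spd: "\<And>n. 1 \<le> n \<Longrightarrow> symmetric_mat (\<Sigma> n)"
      "\<And>n. 1 \<le> n \<Longrightarrow> pos_def_mat (\<Sigma> n)"
    and Sigma_eigenvalues: "\<exists>c>0. \<forall>n\<ge>1. c \<le> smallest_eigenvalue (\<Sigma> n)"
    and beta_dim: "\<And>n. 1 \<le> n \<Longrightarrow> \<beta> n \<in> carrier_vec (p n)"
    and signal: "(\<lambda>n. \<beta> n \<bullet> (\<Sigma> n *\<^sub>v \<beta> n)) \<longlonglongrightarrow> \<tau>\<^sup>2"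
    and Sigma_sqrt: "\<And>n. 1 \<le> n \<Longrightarrow> R n \<in> carrier_mat (p n) (p n)"
      "\<And>n. 1 \<le> n \<Longrightarrow> is_mat_sqrt (R n) (\<Sigma> n)"
    and M_prob: "\<And>n. 1 \<le> n \<Longrightarrow> prob_space (M n)"
    and xt_dim: "\<And>n \<omega>. 1 \<le> n \<Longrightarrow> \<omega> \<in> space (M n) \<Longrightarrow> xt n \<omega> \<in> carrier_vec (p n)"
    and xt_indep: "\<And>n. 1 \<le> n \<Longrightarrow>
      prob_space.indep_vars (M n) (\<lambda>_. borel) (\<lambda>j \<omega>. xt n \<omega> $ j) {..<p n}"
    and xt_distr: "\<And>n j. 1 \<le> n \<Longrightarrow> j < p n \<Longrightarrow> distr (M n) borel (\<lambda>\<omega>. xt n \<omega> $ j) = F"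
    and x_eq: "\<And>n \<omega>. 1 \<le> n \<Longrightarrow> \<omega> \<in> space (M n) \<Longrightarrow> x n \<omega> = R n *\<^sub>v xt n \<omega>"
    and model: "\<And>n. 1 \<le> n \<Longrightarrow> linear_model (M n) (p n) (\<beta> n) (\<sigma> n) (x n) (y n)"
    and sample: "\<And>n. 1 \<le> n \<Longrightarrow> iid_sample (M n) n (p n) (x n) (y n) (xs n) (ys n)"
    and copy: "\<And>n. 1 \<le> n \<Longrightarrow> independent_copy (M n) n (p n) (x n) (xs n) (ys n) (x0 n)"
  shows "(\<lambda>n. squared_bias (M n) n (p n) (\<beta> n) (design_mat n (p n) (xs n)) (x0 n)
                (semisup_ols (M n) (p n) (design_mat n (p n) (xs n)) (response_vec n (ys n))))
           \<longlonglongrightarrow> \<gamma> * \<tau>\<^sup>2"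
proof -
  have F: "prob_space.expectation F (\<lambda>z. z\<^sup>2) = 1"
    using F_variance F_mean by simp
  have bias: "squared_bias (M n) n (p n) (\<beta> n) (design_mat n (p n) (xs n)) (x0 n)
        (semisup_ols (M n) (p n) (design_mat n (p n) (xs n)) (response_vec n (ys n)))
      = (real (p n) + q - 2) / real n * (\<beta> n \<bullet> (\<Sigma> n *\<^sub>v \<beta> n))" if n: "1 \<le> n" for n
  proof -
    interpret whitened_linear_model "M n" n "p n" "\<beta> n" "\<sigma> n" "x n" "x0 n" "y n" "xs n" "ys n"
      F q "xt n" "\<Sigma> n" "R n"
      by (intro whitened_linear_model.intro linear_model_sample.intro iid_coordinates.intro
          linear_model_sample_axioms.intro iid_coordinates_axioms.intro
          whitened_linear_model_axioms.intro)
        (fact n M_prob[OF n] F F_distribution F_mean F_fourth_moment beta_dim[OF n] Sigma_dim[OF n]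
          Sigma_spd(2)[OF n] Sigma_sqrt[OF n] xt_indep[OF n] xt_distr[OF n] xt_dim[OF n] x_eq[OF n]
          model[OF n] sample[OF n] copy[OF n])+
    show ?thesis by (rule squared_bias_eq)
  qed
  \<comment> \<open>\<open>q\<close> is the same for all n, so the fourth moment affects the bias
    only at order 1 / n.\<close>
  have "(\<lambda>n. (q - 2) / real n) \<longlonglongrightarrow> 0"
    by (rule lim_const_over_n)
  from tendsto_mult[OF tendsto_add[OF ratio(1) this] signal]
  have "(\<lambda>n. (real (p n) / real n + (q - 2) / real n) * (\<beta> n \<bullet> (\<Sigma> n *\<^sub>v \<beta> n))) \<longlonglongrightarrow> \<gamma> * \<tau>\<^sup>2"
    by simp
  then show ?thesis
  proof (rule Lim_transform_eventually)
    show "\<forall>\<^sub>F n in sequentially. (real (p n) / real n + (q - 2) / real n) * (\<beta> n \<bullet> (\<Sigma> n *\<^sub>v \<beta> n))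
        = squared_bias (M n) n (p n) (\<beta> n) (design_mat n (p n) (xs n)) (x0 n)
          (semisup_ols (M n) (p n) (design_mat n (p n) (xs n)) (response_vec n (ys n)))"
      \<comment> \<open>The exact formula is available from n = 1 on, which is enough for a
        limit.\<close>
      using eventually_ge_at_top[of 1]
      by eventually_elim (simp add: bias diff_divide_distrib add_divide_distrib)
  qed
qed

end
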